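(* Let $\mathcal M$ be an oriented matroid on a finite ground set $E$ with circuit set $\mathcal C$. Then every $\mathcal M$-separated collection has at most $|\mathrm{Ind}(\mathcal M)|$ elements, and maximal-by-size $\mathcal M$-separated collections have exactly $|\mathrm{Ind}(\mathcal M)|$ elements. Moreover, the map $\mathcal S\mapsto\sigma_{\mathcal S}$ is a bijection from the set of maximal-by-size $\mathcal M$-separated collections $\mathcal S\subseteq 2^E$ onto the set of colocalizations of $\mathcal M$ in general position (equivalently, one-element liftings of $\mathcal M$ in general position), with inverse $\sigma\mapsto\mathcal S(\sigma)$.
   Context: A signed subset of $E$ is a pair $X=(X^+,X^-)$ of disjoint subsets; its support is $\underline X=X^+\cup X^-$ and $-X=(X^-,X^+)$. An oriented matroid $\mathcal M$ on $E$ is given by its set $\mathcal C$ of signed circuits satisfying the circuit axioms (no empty circuit; $X\in\mathcal C\Rightarrow -X\in\mathcal C$; if $\underline X\subseteq\underline Y$ then $X=\pm Y$; weak elimination). A subset of $E$ is independent if it contains the support of no circuit; $\mathrm{Ind}(\mathcal M)$ is the set of independent subsets. Two subsets $I,J\subseteq E$ are $\mathcal M$-separated if there is no circuit $X$ with $X^+\subseteq I\setminus J$ and $X^-\subseteq J\setminus I$; a collection $\mathcal S\subseteq 2^E$ is $\mathcal M$-separated if any two members are $\mathcal M$-separated; it is maximal by size if its cardinality is largest among all $\mathcal M$-separated collections. A set $S\subseteq E$ orients a circuit $Y$ positively if $Y^+\subseteq S$ and $Y^-\cap S=\emptyset$, negatively if $Y^-\subseteq S$ and $Y^+\cap S=\emptyset$.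 For an $\mathcal M$-separated $\mathcal S$, $\sigma_{\mathcal S}:\mathcal C\to\{+,-,0\}$ is $+$ (resp. $-$) on $Y$ if some member of $\mathcal S$ orients $Y$ positively (resp. negatively), and $0$ otherwise. A one-element lifting of $\mathcal M$ is an oriented matroid $\widetilde{\mathcal M}$ on $E\sqcup\{g\}$ with $\widetilde{\mathcal M}/g=\mathcal M$; for each such lifting there is a unique map $\sigma:\mathcal C\to\{+,-,0\}$ (its colocalization) such that $(Y,\sigma(Y))$ is a circuit of $\widetilde{\mathcal M}$ for every $Y\in\mathcal C$, where $(Y,\sigma(Y))$ denotes $Y$ with $g$ added to $Y^+$ if $\sigma(Y)=+$, to $Y^-$ if $\sigma(Y)=-$. The lifting/colocalization is in general position if $\sigma$ takes values only in $\{+,-\}$. For a colocalization $\sigma$ in general position, $\mathcal S(\sigma)$ is the set of all $S\subseteq E$ such that every circuit $Y$ oriented positively (resp. negatively) by $S$ satisfies $\sigma(Y)=+$ (resp. $-$). *)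

theory Defs
  imports Main
begin

text \<open>Signed subsets of a type are pairs (positive part, negative part).\<close>
type_synonym 'a signed = "'a set \<times> 'a set"

definition supp :: "'a signed \<Rightarrow> 'a set" where
  "supp X = fst X \<union> snd X"

definition neg :: "'a signed \<Rightarrow> 'a signed" where
  "neg X = (snd X, fst X)"

definition signed_subset_of :: "'a set \<Rightarrow> 'a signed \<Rightarrow> bool" where
  "signed_subset_of E X \<longleftrightarrow> fst X \<inter> snd X = {} \<and> supp X \<subseteq> E"

definition oriented_matroid :: "'a set \<Rightarrow> 'a signed set \<Rightarrow> bool" where
  "oriented_matroid E C \<longleftrightarrow>
     (\<forall>X\<in>C. signed_subset_of E X) \<and>
     (\<forall>X\<in>C. supp X \<noteq> {}) \<and>
     (\<forall>X\<in>C. neg X \<in> C) \<and>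
     (\<forall>X\<in>C. \<forall>Y\<in>C. supp X \<subseteq> supp Y \<longrightarrow> X = Y \<or> X = neg Y) \<and>
     (\<forall>X\<in>C. \<forall>Y\<in>C. \<forall>e. X \<noteq> neg Y \<and> e \<in> fst X \<inter> snd Y \<longrightarrow>
        (\<exists>Z\<in>C. fst Z \<subseteq> (fst X \<union> fst Y) - {e} \<and> snd Z \<subseteq> (snd X \<union> snd Y) - {e}))"

definition Ind :: "'a set \<Rightarrow> 'a signed set \<Rightarrow> 'a set set" where
  "Ind E C = {I. I \<subseteq> E \<and> \<not> (\<exists>X\<in>C. supp X \<subseteq> I)}"

definition M_separated :: "'a signed set \<Rightarrow> 'a set \<Rightarrow> 'a set \<Rightarrow> bool" where
  "M_separated C I J \<longleftrightarrow> \<not> (\<exists>X\<in>C. fst X \<subseteq> I - J \<and> snd X \<subseteq> J - I)"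

definition separated_collection :: "'a set \<Rightarrow> 'a signed set \<Rightarrow> 'a set set \<Rightarrow> bool" where
  "separated_collection E C S \<longleftrightarrow> S \<subseteq> Pow E \<and> (\<forall>I\<in>S. \<forall>J\<in>S. M_separated C I J)"

definition max_by_size :: "'a set \<Rightarrow> 'a signed set \<Rightarrow> 'a set set \<Rightarrow> bool" where
  "max_by_size E C S \<longleftrightarrow> separated_collection E C S \<and>
     (\<forall>T. separated_collection E C T \<longrightarrow> card T \<le> card S)"

datatype sign = Pos | Neg | Zero

definition orients_pos :: "'a set \<Rightarrow> 'a signed \<Rightarrow> bool" where
  "orients_pos S Y \<longleftrightarrow> fst Y \<subseteq> S \<and> snd Y \<inter> S = {}"

definition orients_neg :: "'a set \<Rightarrow> 'a signed \<Rightarrow> bool" where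
  "orients_neg S Y \<longleftrightarrow> snd Y \<subseteq> S \<and> fst Y \<inter> S = {}"

text \<open>sigma_S; maps on C are represented as total functions equal to Zero outside C.\<close>
definition sigma_of :: "'a signed set \<Rightarrow> 'a set set \<Rightarrow> 'a signed \<Rightarrow> sign" where
  "sigma_of C S Y =
     (if Y \<notin> C then Zero
      else if \<exists>T\<in>S. orients_pos T Y then Pos
      else if \<exists>T\<in>S. orients_neg T Y then Neg
      else Zero)"

text \<open>The extended ground set E \<sqcup> {g} is modelled in type 'a option with g = None.\<close>
definition lift_signed :: "'a signed \<Rightarrow> sign \<Rightarrow> 'a option signed" where
  "lift_signed Y s =
     (Some ` fst Y \<union> (if s = Pos then {None} else {}),
      Some ` snd Y \<union> (if s = Neg then {None} else {}))"

definition restrict_signed :: "'a option signed \<Rightarrow> 'a signed" where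
  "restrict_signed X = (Some -` fst X, Some -` snd X)"

definition contract_g :: "'a option signed set \<Rightarrow> 'a signed set" where
  "contract_g Ct =
     {Z. Z \<in> restrict_signed ` Ct \<and> supp Z \<noteq> {} \<and>
         \<not> (\<exists>W\<in>restrict_signed ` Ct. supp W \<noteq> {} \<and> supp W \<subset> supp Z)}"

definition lifting :: "'a set \<Rightarrow> 'a signed set \<Rightarrow> 'a option signed set \<Rightarrow> bool" where
  "lifting E C Ct \<longleftrightarrow> oriented_matroid (insert None (Some ` E)) Ct \<and> contract_g Ct = C"

definition colocalization :: "'a set \<Rightarrow> 'a signed set \<Rightarrow> ('a signed \<Rightarrow> sign) \<Rightarrow> bool" where
  "colocalization E C \<sigma> \<longleftrightarrow> (\<forall>Y. Y \<notin> C \<longrightarrow> \<sigma> Y = Zero) \<and>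
     (\<exists>Ct. lifting E C Ct \<and> (\<forall>Y\<in>C. lift_signed Y (\<sigma> Y) \<in> Ct))"

definition general_position :: "'a signed set \<Rightarrow> ('a signed \<Rightarrow> sign) \<Rightarrow> bool" where
  "general_position C \<sigma> \<longleftrightarrow> (\<forall>Y\<in>C. \<sigma> Y \<noteq> Zero)"

definition S_of :: "'a set \<Rightarrow> 'a signed set \<Rightarrow> ('a signed \<Rightarrow> sign) \<Rightarrow> 'a set set" where
  "S_of E C \<sigma> = {S. S \<subseteq> E \<and>
     (\<forall>Y\<in>C. (orients_pos S Y \<longrightarrow> \<sigma> Y = Pos) \<and> (orients_neg S Y \<longrightarrow> \<sigma> Y = Neg))}"

end

theory Submission
  imports Defs
begin

text \<open>
  A separated collection shatters only independent sets: shattering the support of a circuit \<open>Y\<close>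
  would provide members orienting \<open>Y\<close> in opposite ways.  Pajor's lemma (a family has at most as many
  members as shattered sets) then gives the upper bound, and in the case of equality the family is
  ample, i.e. it contains a cube in the directions of every set it shatters.

  A sign function \<open>\<sigma>\<close> without zeros is encoded by the set \<open>P\<close> of circuits of sign \<open>+\<close>.  It is a
  colocalization iff \<open>P\<close> contains exactly one of \<open>Y\<close>, \<open>-Y\<close> for each circuit \<open>Y\<close> and is closed under
  elimination.  For such \<open>P\<close>, a greedy choice of signs outside an independent set \<open>I\<close> produces a cube
  in the directions of \<open>I\<close> inside \<open>S(\<sigma>)\<close>; as a family has at least as many members as direction sets
  of cubes, \<open>S(\<sigma>)\<close> attains the bound.  Conversely, ampleness makes the set of circuits oriented
  positively by a tight separated collection closed under elimination.  Such a \<open>P\<close> exists: take the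
  circuits whose largest element, in some linear order of the ground set, is positive.
\<close>

subsection \<open>Signed sets and strong elimination\<close>

text \<open>Everything hinges on elimination, whose bound \<open>elim X Y e\<close> carries both
  signs at every conflict other than \<open>e\<close>. For a tight collection this freedom is
  matched by a cube: if no positive circuit lay below the bound, every choice of signs at the
  remaining conflicts would be realised by a member whose other signs are opposite to the bound;
  ampleness turns these members into one cube with a constant value at \<open>e\<close>, and that
  value realises \<open>neg X\<close> or \<open>neg Y\<close>. For liftings the obstacle is that the
  sign function describes only circuits through \<open>g\<close>. Those avoiding \<open>g\<close>
  have to be constructed, and a positive and a negative circuit found below a bound may be opposite
  to each other, which gives nothing new. Strong elimination, not part of the axioms, overcomes this
  by keeping a chosen element; it also keeps the largest element in the existence argument.\<close>

definition conformal_le :: "'a signed \<Rightarrow> 'a signed \<Rightarrow> bool" (infix "\<sqsubseteq>" 50) where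
  "X \<sqsubseteq> Y \<longleftrightarrow> fst X \<subseteq> fst Y \<and> snd X \<subseteq> snd Y"

definition sepr :: "'a signed \<Rightarrow> 'a signed \<Rightarrow> 'a set" where
  "sepr X Y = fst X \<inter> snd Y \<union> snd X \<inter> fst Y"

text \<open>The upper bound in circuit elimination. It need not be a signed set: a conflict of
  \<open>X\<close> and \<open>Y\<close> other than \<open>e\<close> lies in both parts, so anything
  below may take either sign there.\<close>

definition elim :: "'a signed \<Rightarrow> 'a signed \<Rightarrow> 'a \<Rightarrow> 'a signed" where
  "elim X Y e = ((fst X \<union> fst Y) - {e}, (snd X \<union> snd Y) - {e})"

lemma neg_simps [simp]:
  "fst (neg X) = snd X" "snd (neg X) = fst X" "neg (neg X) = X" "supp (neg X) = supp X"
  "neg X \<sqsubseteq> neg Y \<longleftrightarrow> X \<sqsubseteq> Y" "elim (neg X) (neg Y) e = neg (elim X Y e)"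
  "sepr (neg X) (neg Y) = sepr X Y"
  by (auto simp: neg_def supp_def conformal_le_def elim_def sepr_def)

lemma neg_eq_iff: "neg X = neg Y \<longleftrightarrow> X = Y" "X = neg Y \<longleftrightarrow> neg X = Y"
  by (metis neg_simps(3))+

lemma sepr_commute: "sepr X Y = sepr Y X"
  by (auto simp: sepr_def)

lemma elim_commute: "elim X Y e = elim Y X e"
  by (auto simp: elim_def)

lemma conformal_le_refl [simp]: "X \<sqsubseteq> X"
  by (simp add: conformal_le_def)

lemma conformal_le_trans: "X \<sqsubseteq> Y \<Longrightarrow> Y \<sqsubseteq> Z \<Longrightarrow> X \<sqsubseteq> Z"
  by (auto simp: conformal_le_def)

lemma conformal_le_supp: "X \<sqsubseteq> Y \<Longrightarrow> supp X \<subseteq> supp Y"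
  by (auto simp: conformal_le_def supp_def)

lemma conformal_le_neg_left: "neg X \<sqsubseteq> Y \<longleftrightarrow> X \<sqsubseteq> neg Y"
  by (auto simp: conformal_le_def)

lemma conformal_le_supp_eq:
  assumes "X \<sqsubseteq> Y" "supp Y \<subseteq> supp X" "fst Y \<inter> snd Y = {}"
  shows "X = Y"
  using assms by (intro prod_eqI) (auto simp: conformal_le_def supp_def)

lemma elim_mono: "W \<sqsubseteq> X \<Longrightarrow> V \<sqsubseteq> Y \<Longrightarrow> elim W V e \<sqsubseteq> elim X Y e"
  unfolding conformal_le_def elim_def by auto

lemma sepr_mono: "W \<sqsubseteq> X \<Longrightarrow> V \<sqsubseteq> Y \<Longrightarrow> sepr W V \<subseteq> sepr X Y"
  unfolding conformal_le_def sepr_def by auto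

text \<open>A set avoiding \<open>e\<close> already lies below the bound, so elimination is needed
  only when both \<open>W\<close> and \<open>V\<close> contain \<open>e\<close>, and then they
  inherit the opposite signs of \<open>X\<close> and \<open>Y\<close>. This transfers elimination to
  signed sets that merely contain circuits.\<close>

lemma sepr_cases:
  assumes "W \<sqsubseteq> X" "V \<sqsubseteq> Y" "fst X \<inter> snd X = {}" "fst Y \<inter> snd Y = {}" "e \<in> sepr X Y"
  obtains "W \<sqsubseteq> elim X Y e" | "V \<sqsubseteq> elim X Y e" | "e \<in> supp W" "e \<in> sepr W V"
proof -
  have "W \<sqsubseteq> elim X Y e" if "e \<notin> supp W"
    using that assms(1) by (auto simp: conformal_le_def elim_def supp_def)
  moreover have "V \<sqsubseteq> elim X Y e" if "e \<notin> supp V"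
    using that assms(2) by (auto simp: conformal_le_def elim_def supp_def)
  moreover have "e \<in> sepr W V" if "e \<in> supp W" "e \<in> supp V"
    using that assms by (auto simp: conformal_le_def sepr_def supp_def)
  ultimately show thesis using that by blast
qed

lemma orients_neg_iff: "orients_neg T Y \<longleftrightarrow> orients_pos T (neg Y)"
  by (simp add: orients_neg_def orients_pos_def)

lemma orients_pos_iff:
  "fst Y \<inter> snd Y = {} \<Longrightarrow> orients_pos T Y \<longleftrightarrow> T \<inter> supp Y = fst Y"
  unfolding orients_pos_def supp_def by blast

locale oriented_matroid_on =
  fixes E :: "'a set" and C :: "'a signed set"
  assumes finite_E: "finite E" and om: "oriented_matroid E C"
begin

lemma circuit_disjoint: "X \<in> C \<Longrightarrow> fst X \<inter> snd X = {}"
  and circuit_supp: "X \<in> C \<Longrightarrow> supp X \<subseteq> E"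
  and circuit_nonempty: "X \<in> C \<Longrightarrow> supp X \<noteq> {}"
  and circuit_clutter: "X \<in> C \<Longrightarrow> Y \<in> C \<Longrightarrow> supp X \<subseteq> supp Y \<Longrightarrow> X = Y \<or> X = neg Y"
  using om by (auto simp: oriented_matroid_def signed_subset_of_def)

lemma neg_circuit_iff [simp]: "neg X \<in> C \<longleftrightarrow> X \<in> C"
  using om unfolding oriented_matroid_def by (metis neg_simps(3))

lemma finite_supp: "X \<in> C \<Longrightarrow> finite (supp X)"
  using circuit_supp finite_E finite_subset by blast

lemma finite_sepr: "X \<in> C \<Longrightarrow> finite (sepr X Y)"
  by (rule finite_subset[OF _ finite_supp]) (auto simp: sepr_def supp_def)

lemma circuit_neq_neg: "X \<in> C \<Longrightarrow> X \<noteq> neg X"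
  using circuit_disjoint[of X] circuit_nonempty[of X]
  by (metis Un_absorb inf.idem neg_simps(1) supp_def)

lemma weak_elim:
  assumes "X \<in> C" "Y \<in> C" "X \<noteq> neg Y" "e \<in> sepr X Y"
  shows "\<exists>Z\<in>C. Z \<sqsubseteq> elim X Y e"
proof -
  have *: "\<exists>Z\<in>C. Z \<sqsubseteq> elim X Y e"
    if "X \<in> C" "Y \<in> C" "X \<noteq> neg Y" "e \<in> fst X \<inter> snd Y" for X Y
    using om that unfolding oriented_matroid_def conformal_le_def elim_def by simp
  show ?thesis
  proof (cases "e \<in> fst X \<inter> snd Y")
    case True
    then show ?thesis using * assms by blast
  next
    case False
    then have "e \<in> fst Y \<inter> snd X" using assms(4) by (auto simp: sepr_def)
    then show ?thesis using *[of Y X] assms elim_commute neg_eq_iff(2) by metis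
  qed
qed

text \<open>Wrong signs of \<open>Z1\<close> on the support of \<open>Z0\<close> are removed one at a time by eliminating with \<open>Z0\<close>.\<close>
lemma repair_signs:
  assumes elim: "\<And>X Y e. X \<in> C \<Longrightarrow> Y \<in> C \<Longrightarrow> e \<in> sepr X Y \<Longrightarrow> f \<in> supp X \<Longrightarrow> f \<notin> supp Y
      \<Longrightarrow> supp X \<union> supp Y \<subseteq> B \<Longrightarrow> \<exists>Z\<in>C. Z \<sqsubseteq> elim X Y e \<and> f \<in> supp Z"
    and Z0: "Z0 \<in> C" "Z0 \<sqsubseteq> G" "f \<notin> supp Z0" "supp Z0 \<subseteq> B"
    and Z1: "Z1 \<in> C" "f \<in> supp Z1" "supp Z1 \<subseteq> B"
      "Z1 \<sqsubseteq> (fst G \<union> supp Z0, snd G \<union> supp Z0)"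
  shows "\<exists>Z\<in>C. Z \<sqsubseteq> G \<and> f \<in> supp Z"
  using Z1
proof (induction "card (sepr Z1 Z0)" arbitrary: Z1 rule: less_induct)
  case less
  show ?case
  proof (cases "sepr Z1 Z0 = {}")
    case True
    then have "Z1 \<sqsubseteq> G"
      using less.prems(4) Z0(2) unfolding sepr_def conformal_le_def supp_def by auto
    then show ?thesis using less.prems by blast
  next
    case False
    then obtain x where x: "x \<in> sepr Z1 Z0" by blast
    then obtain Z2 where Z2: "Z2 \<in> C" "Z2 \<sqsubseteq> elim Z1 Z0 x" "f \<in> supp Z2"
      using elim[of Z1 Z0 x] less.prems Z0 by blast
    \<comment> \<open>Signs taken over from \<open>Z0\<close> agree with \<open>Z0\<close>, so no
      new conflict appears, and \<open>x\<close> has left the support.\<close>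
    have "sepr Z2 Z0 \<subset> sepr Z1 Z0"
      using Z2(2) circuit_disjoint[OF Z0(1)] x
      unfolding sepr_def conformal_le_def elim_def by auto
    then have "card (sepr Z2 Z0) < card (sepr Z1 Z0)"
      by (rule psubset_card_mono[OF finite_sepr[OF less.prems(1)]])
    moreover have "supp Z2 \<subseteq> B"
      using Z2(2) less.prems(3) Z0(4) unfolding conformal_le_def elim_def supp_def by auto
    moreover have "Z2 \<sqsubseteq> (fst G \<union> supp Z0, snd G \<union> supp Z0)"
      using Z2(2) less.prems(4) unfolding conformal_le_def elim_def supp_def by auto
    ultimately show ?thesis using less.hyps Z2 by blast
  qed
qed

text \<open>A case of the Bland-Las Vergnas theorem that weak elimination implies strong
  elimination. A \<open>Z0\<close> that misses \<open>f\<close> must leave \<open>supp X\<close> by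
  the clutter axiom; an element \<open>x\<close> found there serves to modify \<open>Y\<close> into
  \<open>W\<close>, and eliminating \<open>e\<close> between \<open>X\<close> and \<open>W\<close>
  keeps \<open>f\<close>. Both eliminations take place in a smaller union of supports (without
  \<open>f\<close>, then without \<open>x\<close>), as the induction requires.\<close>

lemma strong_elim_outside:
  assumes "X \<in> C" "Y \<in> C" "e \<in> sepr X Y" "f \<in> supp X" "f \<notin> supp Y"
  shows "\<exists>Z\<in>C. Z \<sqsubseteq> elim X Y e \<and> f \<in> supp Z"
  using assms
proof (induction "card (supp X \<union> supp Y)" arbitrary: X Y e f rule: less_induct)
  case less
  note X = less.prems(1) and Y = less.prems(2) and e = less.prems(3) and f = less.prems(4,5)
  have IH: "\<exists>Z\<in>C. Z \<sqsubseteq> elim X' Y' e' \<and> f' \<in> supp Z"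
    if "supp X' \<union> supp Y' \<subset> supp X \<union> supp Y"
      "X' \<in> C" "Y' \<in> C" "e' \<in> sepr X' Y'" "f' \<in> supp X'" "f' \<notin> supp Y'" for X' Y' e' f'
    by (rule less.hyps[OF psubset_card_mono[OF _ that(1)] that(2-)]) (simp add: finite_supp X Y)
  have e': "e \<in> supp X" "e \<in> supp Y" using e by (auto simp: sepr_def supp_def)
  have "X \<noteq> neg Y" using f by auto
  then obtain Z0 where Z0: "Z0 \<in> C" "Z0 \<sqsubseteq> elim X Y e" using weak_elim X Y e by blast
  show ?case
  proof (cases "f \<in> supp Z0")
    case True
    then show ?thesis using Z0 by blast
  next
    case False
    have Z0s: "supp Z0 \<subseteq> supp X \<union> supp Y - {e}"
      using Z0(2) by (auto simp: conformal_le_def elim_def supp_def)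
    have "\<not> supp Z0 \<subseteq> supp X"
      using circuit_clutter[OF Z0(1) X] Z0s f(1) False by auto
    then obtain x where x: "x \<in> supp Z0" "x \<notin> supp X" by blast
    \<comment> \<open>Off \<open>supp X\<close> the signs of \<open>Z0\<close> can only come from
      \<open>Y\<close>, so \<open>Y\<close> and \<open>neg Z0\<close> conflict at
      \<open>x\<close>.\<close>
    have sep: "x \<in> sepr Y (neg Z0)"
      using x Z0(2) by (auto simp: conformal_le_def elim_def supp_def sepr_def)
    have sub: "supp Y \<union> supp (neg Z0) \<subset> supp X \<union> supp Y"
      using Z0s f False by auto
    have "neg Z0 \<in> C" "e \<notin> supp (neg Z0)" using Z0 Z0s by auto
    then obtain W where W: "W \<in> C" "W \<sqsubseteq> elim Y (neg Z0) x" "e \<in> supp W"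
      using IH[OF sub Y _ sep e'(2)] by blast
    have W': "supp W \<subseteq> supp X \<union> supp Y - {x}" "f \<notin> supp W"
      using W(2) Z0s f False by (auto simp: conformal_le_def elim_def supp_def)
    have sep: "e \<in> sepr X W"
      using W(2,3) Z0s e circuit_disjoint[OF Y]
      by (auto simp: conformal_le_def elim_def supp_def sepr_def)
    have "x \<in> supp Y" "x \<notin> supp W" using x Z0s W' by auto
    then have sub: "supp X \<union> supp W \<subset> supp X \<union> supp Y" using W' x by auto
    obtain V where V: "V \<in> C" "V \<sqsubseteq> elim X W e" "f \<in> supp V"
      using IH[OF sub X W(1) sep f(1) W'(2)] by blast
    have Vs: "supp V \<subseteq> supp X \<union> supp Y - {e}"
      using V(2) W' by (auto simp: conformal_le_def elim_def supp_def)
    \<comment> \<open>The wrong signs of \<open>V\<close> were taken over from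
      \<open>neg Z0\<close>, so they sit on \<open>supp Z0\<close>. The repair stays inside a union
      that misses \<open>e\<close>, where the induction hypothesis applies.\<close>
    show ?thesis
    proof (rule repair_signs[where B = "supp X \<union> supp Y - {e}"])
      show "V \<sqsubseteq> (fst (elim X Y e) \<union> supp Z0, snd (elim X Y e) \<union> supp Z0)"
        using V(2) W(2) by (auto simp: conformal_le_def elim_def supp_def)
      show "\<exists>Z\<in>C. Z \<sqsubseteq> elim X' Y' e' \<and> f \<in> supp Z"
        if "X' \<in> C" "Y' \<in> C" "e' \<in> sepr X' Y'" "f \<in> supp X'" "f \<notin> supp Y'"
          "supp X' \<union> supp Y' \<subseteq> supp X \<union> supp Y - {e}" for X' Y' e'
        using IH[of X' Y' e' f] that e' by blast
    qed (use Z0 Z0s False V Vs in auto)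
  qed
qed

text \<open>What remains is \<open>f\<close> in both supports with the same sign. The scheme of
  \<open>strong_elim_outside\<close> is repeated; only the elimination between \<open>X\<close> and
  \<open>W\<close> again has \<open>f\<close> in both supports, and it is left to the induction,
  since \<open>x\<close> is lost.\<close>

lemma strong_elim:
  assumes "X \<in> C" "Y \<in> C" "e \<in> sepr X Y" "f \<in> supp X" "f \<notin> sepr X Y"
  shows "\<exists>Z\<in>C. Z \<sqsubseteq> elim X Y e \<and> f \<in> supp Z"
  using assms
proof (induction "card (supp X \<union> supp Y)" arbitrary: Y rule: less_induct)
  case less
  note X = less.prems(1) and Y = less.prems(2) and e = less.prems(3) and f = less.prems(4,5)
  have e': "e \<in> supp X" "e \<in> supp Y" using e by (auto simp: sepr_def supp_def)
  have "X \<noteq> neg Y" using f by (auto simp: sepr_def supp_def)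
  then obtain Z0 where Z0: "Z0 \<in> C" "Z0 \<sqsubseteq> elim X Y e" using weak_elim X Y e by blast
  consider "f \<notin> supp Y" | "f \<in> supp Z0" | "f \<in> supp Y" "f \<notin> supp Z0" by blast
  then show ?case
  proof cases
    case 1
    then show ?thesis using strong_elim_outside less.prems by blast
  next
    case 2
    then show ?thesis using Z0 by blast
  next
    case 3
    have Z0s: "supp Z0 \<subseteq> supp X \<union> supp Y - {e}"
      using Z0(2) by (auto simp: conformal_le_def elim_def supp_def)
    have "\<not> supp Z0 \<subseteq> supp X"
      using circuit_clutter[OF Z0(1) X] Z0s f(1) 3 by auto
    then obtain x where x: "x \<in> supp Z0" "x \<notin> supp X" by blast
    have "x \<in> sepr Y (neg Z0)"
      using x Z0(2) by (auto simp: conformal_le_def elim_def supp_def sepr_def)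
    then obtain W where W: "W \<in> C" "W \<sqsubseteq> elim Y (neg Z0) x" "f \<in> supp W"
      using strong_elim_outside[of Y "neg Z0" x f] Y Z0 3 by auto
    have W': "supp W \<subseteq> supp X \<union> supp Y - {x}" "f \<notin> sepr X W"
      using W(2) Z0s f 3 by (auto simp: conformal_le_def elim_def supp_def sepr_def)
    obtain V where V: "V \<in> C" "V \<sqsubseteq> elim X W e" "f \<in> supp V"
    proof (cases "e \<in> supp W")
      case True
      have "e \<in> sepr X W"
        using W(2) True Z0s e circuit_disjoint[OF Y]
        by (auto simp: conformal_le_def elim_def supp_def sepr_def)
      moreover have "x \<in> supp Y" "x \<notin> supp W" using x Z0s W' by auto
      then have "supp X \<union> supp W \<subset> supp X \<union> supp Y" using W' x by auto
      then have "card (supp X \<union> supp W) < card (supp X \<union> supp Y)"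
        by (intro psubset_card_mono) (simp add: finite_supp X Y)
      ultimately show ?thesis using that less.hyps[of W] X W(1) f W' by blast
    next
      case False
      then have "W \<sqsubseteq> elim X W e" by (auto simp: conformal_le_def elim_def supp_def)
      then show ?thesis using that W by blast
    qed
    have Vs: "supp V \<subseteq> supp X \<union> supp Y - {e}"
      using V(2) W' by (auto simp: conformal_le_def elim_def supp_def)
    show ?thesis
    proof (rule repair_signs[where B = "supp X \<union> supp Y - {e}"])
      show "V \<sqsubseteq> (fst (elim X Y e) \<union> supp Z0, snd (elim X Y e) \<union> supp Z0)"
        using V(2) W(2) by (auto simp: conformal_le_def elim_def supp_def)
      show "\<exists>Z\<in>C. Z \<sqsubseteq> elim X' Y' e' \<and> f \<in> supp Z"
        if "X' \<in> C" "Y' \<in> C" "e' \<in> sepr X' Y'" "f \<in> supp X'" "f \<notin> supp Y'"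
        for X' Y' e'
        using strong_elim_outside[of X' Y' e' f] that by blast
    qed (use Z0 Z0s 3 V Vs in auto)
  qed
qed

end

subsection \<open>Shattering and ample families\<close>

definition shatters :: "'a set set \<Rightarrow> 'a set \<Rightarrow> bool" where
  "shatters S A \<longleftrightarrow> (\<forall>B\<subseteq>A. \<exists>T\<in>S. T \<inter> A = B)"

text \<open>Strong shattering. Only \<open>T - A\<close> matters: it is the fixed part shared by all
  vertices of the cube.\<close>

definition has_cube :: "'a set set \<Rightarrow> 'a set \<Rightarrow> bool" where
  "has_cube S A \<longleftrightarrow> (\<exists>T. \<forall>B\<subseteq>A. (T - A) \<union> B \<in> S)"

text \<open>Such families are also called lopsided or shattering-extremal.\<close>

definition ample :: "'a set set \<Rightarrow> bool" where
  "ample S \<longleftrightarrow> (\<forall>A. shatters S A \<longrightarrow> has_cube S A)"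

section \<open>Counting shattered sets and directions of cubes\<close>

lemma card_subsets_insert:
  assumes "finite F" "e \<notin> F"
  shows "card {A. A \<subseteq> insert e F \<and> Q A} = card {A. A \<subseteq> F \<and> Q A} + card {A. A \<subseteq> F \<and> Q (insert e A)}"
proof -
  have "{A. A \<subseteq> insert e F \<and> Q A} = {A. A \<subseteq> F \<and> Q A} \<union> insert e ` {A. A \<subseteq> F \<and> Q (insert e A)}"
    (is "?L = ?A \<union> insert e ` ?B")
  proof (intro equalityI subsetI)
    fix A assume A: "A \<in> ?L"
    show "A \<in> ?A \<union> insert e ` ?B"
    proof (cases "e \<in> A")
      case True
      then have "A = insert e (A - {e})" by blast
      moreover have "A - {e} \<in> ?B" using A True by (auto simp: insert_absorb)
      ultimately show ?thesis by blast
    qed (use A in auto)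
  qed auto
  moreover have "inj_on (insert e) ?B"
    using assms(2) by (auto simp: inj_on_def)
  moreover have "?A \<inter> insert e ` ?B = {}" using assms(2) by auto
  ultimately show ?thesis
    using assms(1) by (simp add: card_Un_disjoint card_image)
qed

text \<open>Deleting \<open>e\<close> is at most two-to-one on \<open>S\<close>, and the second
  summand counts the sets with two preimages. Both counting bounds below rest on this split into a
  trace and a link.\<close>

lemma card_family_split:
  assumes "finite S"
  shows "card S = card ((\<lambda>T. T - {e}) ` S) + card {T \<in> S. e \<notin> T \<and> insert e T \<in> S}"
proof -
  define S0 where "S0 = {T \<in> S. e \<notin> T}"
  define S1 where "S1 = {T \<in> S. e \<in> T}"
  define R where "R = (\<lambda>T. T - {e}) ` S1"
  have fin: "finite S0" "finite S1" "finite R" using assms by (simp_all add: S0_def S1_def R_def)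
  have S: "S0 \<union> S1 = S" "S0 \<inter> S1 = {}" by (auto simp: S0_def S1_def)
  have "inj_on (\<lambda>T. T - {e}) S1"
  proof (rule inj_onI)
    fix T T' assume "T \<in> S1" "T' \<in> S1" "T - {e} = T' - {e}"
    then have "insert e (T - {e}) = insert e (T' - {e})" by simp
    then show "T = T'" using \<open>T \<in> S1\<close> \<open>T' \<in> S1\<close> by (simp add: S1_def insert_absorb)
  qed
  then have "card S1 = card R" unfolding R_def by (rule card_image[symmetric])
  then have "card S = card (S0 \<union> R) + card (S0 \<inter> R)"
    using card_Un_disjoint[OF fin(1,2) S(2)] S(1) card_Un_Int[OF fin(1,3)] by simp
  moreover have "S0 \<union> R = (\<lambda>T. T - {e}) ` S"
  proof -
    have "(\<lambda>T. T - {e}) ` S0 = (\<lambda>T. T) ` S0" by (rule image_cong) (auto simp: S0_def)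
    then show ?thesis by (simp add: S(1)[symmetric] image_Un R_def)
  qed
  moreover have "S0 \<inter> R = {T \<in> S. e \<notin> T \<and> insert e T \<in> S}"
  proof -
    have "T \<in> R \<longleftrightarrow> insert e T \<in> S" if "e \<notin> T" for T
    proof
      show "insert e T \<in> S" if "T \<in> R" using that by (auto simp: R_def S1_def insert_absorb)
      show "T \<in> R" if "insert e T \<in> S"
        unfolding R_def
        by (rule image_eqI[of _ _ "insert e T"]) (use that \<open>e \<notin> T\<close> in \<open>auto simp: S1_def\<close>)
    qed
    then show ?thesis unfolding S0_def by blast
  qed
  ultimately show ?thesis by simp
qed

lemma shatters_trace:
  assumes "e \<notin> A" "shatters ((\<lambda>T. T - {e}) ` S) A"
  shows "shatters S A"
proof -
  have "(T - {e}) \<inter> A = T \<inter> A" for T using assms(1) by auto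
  then show ?thesis using assms(2) by (auto simp: shatters_def)
qed

lemma shatters_insert:
  assumes "e \<notin> A" "shatters {T \<in> S. e \<notin> T \<and> insert e T \<in> S} A"
  shows "shatters S (insert e A)"
  unfolding shatters_def
proof (intro allI impI)
  fix B assume B: "B \<subseteq> insert e A"
  then obtain T where T: "T \<in> S" "e \<notin> T" "insert e T \<in> S" "T \<inter> A = B - {e}"
    using assms(2) unfolding shatters_def by (auto dest!: spec[of _ "B - {e}"])
  show "\<exists>T\<in>S. T \<inter> insert e A = B"
  proof (cases "e \<in> B")
    case True
    then have "insert e T \<inter> insert e A = B" using T B by auto
    then show ?thesis using T by blast
  next
    case False
    then have "T \<inter> insert e A = B" using T B by auto
    then show ?thesis using T by blast
  qed
qed

lemma has_cube_trace:
  assumes "e \<notin> A" "has_cube S A"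
  shows "has_cube ((\<lambda>T. T - {e}) ` S) A"
proof -
  obtain T where T: "\<And>B. B \<subseteq> A \<Longrightarrow> (T - A) \<union> B \<in> S"
    using assms(2) by (auto simp: has_cube_def)
  have "(T - {e} - A) \<union> B = ((T - A) \<union> B) - {e}" if "B \<subseteq> A" for B
    using that assms(1) by auto
  then show ?thesis using T unfolding has_cube_def by (metis imageI)
qed

text \<open>A cube in direction \<open>e\<close> consists of pairs \<open>T\<close>,
  \<open>insert e T\<close>, so nothing is lost in passing to the link, whereas shattering allows
  only one implication there. In exchange the trace may gain cubes. Hence shattered sets and cubes
  bound \<open>card S\<close> from opposite sides.\<close>

lemma has_cube_insert_iff:
  assumes "e \<notin> A"
  shows "has_cube S (insert e A) \<longleftrightarrow> has_cube {T \<in> S. e \<notin> T \<and> insert e T \<in> S} A"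
proof
  assume "has_cube S (insert e A)"
  then obtain T where T: "\<And>B. B \<subseteq> insert e A \<Longrightarrow> (T - insert e A) \<union> B \<in> S"
    by (auto simp: has_cube_def)
  have "(T - {e} - A) \<union> B \<in> {T \<in> S. e \<notin> T \<and> insert e T \<in> S}" if "B \<subseteq> A" for B
  proof -
    have "(T - {e} - A) \<union> B = (T - insert e A) \<union> B" by auto
    moreover have "insert e ((T - {e} - A) \<union> B) = (T - insert e A) \<union> insert e B" by auto
    ultimately show ?thesis using T[of B] T[of "insert e B"] that assms by auto
  qed
  then show "has_cube {T \<in> S. e \<notin> T \<and> insert e T \<in> S} A"
    unfolding has_cube_def by blast
next
  assume "has_cube {T \<in> S. e \<notin> T \<and> insert e T \<in> S} A"
  then obtain T where
    T: "\<And>B. B \<subseteq> A \<Longrightarrow> (T - A) \<union> B \<in> {T \<in> S. e \<notin> T \<and> insert e T \<in> S}"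
    by (auto simp: has_cube_def)
  have "e \<notin> T" using T[of "{}"] assms by auto
  have "(T - insert e A) \<union> B \<in> S" if "B \<subseteq> insert e A" for B
  proof (cases "e \<in> B")
    case True
    have "insert e ((T - A) \<union> (B - {e})) \<in> S" using T[of "B - {e}"] that by blast
    moreover have "insert e ((T - A) \<union> (B - {e})) = (T - insert e A) \<union> B"
      using True by auto
    ultimately show ?thesis by simp
  next
    case False
    have "(T - A) \<union> B \<in> S" using T[of B] that False by blast
    moreover have "(T - A) \<union> B = (T - insert e A) \<union> B" using \<open>e \<notin> T\<close> by auto
    ultimately show ?thesis by simp
  qed
  then show "has_cube S (insert e A)" unfolding has_cube_def by blast
qed

lemma card_le_card_shattered:
  assumes "finite E" "S \<subseteq> Pow E"
  shows "card S \<le> card {A. A \<subseteq> E \<and> shatters S A}"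
  using assms
proof (induction E arbitrary: S rule: finite_induct)
  case empty
  show ?case
  proof (cases "S = {}")
    case False
    then have "S = {{}}" using empty by auto
    then have "{A. A \<subseteq> {} \<and> shatters S A} = {{}}" by (auto simp: shatters_def)
    then show ?thesis using \<open>S = {{}}\<close> by simp
  qed simp
next
  case (insert e F)
  let ?S' = "(\<lambda>T. T - {e}) ` S" and ?S'' = "{T \<in> S. e \<notin> T \<and> insert e T \<in> S}"
  have "finite S" using insert by (meson finite_Pow_iff finite_insert finite_subset)
  then have "card S = card ?S' + card ?S''" by (rule card_family_split)
  also have "\<dots> \<le> card {A. A \<subseteq> F \<and> shatters ?S' A} + card {A. A \<subseteq> F \<and> shatters ?S'' A}"
    using insert.prems by (intro add_mono insert.IH) auto
  also have "\<dots> \<le> card {A. A \<subseteq> F \<and> shatters S A} + card {A. A \<subseteq> F \<and> shatters S (insert e A)}"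
    using insert.hyps by (intro add_mono card_mono) (auto intro: shatters_trace shatters_insert)
  also have "\<dots> = card {A. A \<subseteq> insert e F \<and> shatters S A}"
    using insert.hyps by (simp add: card_subsets_insert)
  finally show ?case .
qed

lemma card_cubes_le_card:
  assumes "finite E" "S \<subseteq> Pow E"
  shows "card {A. A \<subseteq> E \<and> has_cube S A} \<le> card S"
  using assms
proof (induction E arbitrary: S rule: finite_induct)
  case empty
  show ?case
  proof (cases "S = {}")
    case False
    then have "S = {{}}" using empty by auto
    moreover have "card {A. A \<subseteq> {} \<and> has_cube S A} \<le> card {{} :: 'a set}"
      by (rule card_mono) auto
    ultimately show ?thesis by simp
  qed (simp add: has_cube_def)
next
  case (insert e F)
  let ?S' = "(\<lambda>T. T - {e}) ` S" and ?S'' = "{T \<in> S. e \<notin> T \<and> insert e T \<in> S}"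
  have "finite S" using insert by (meson finite_Pow_iff finite_insert finite_subset)
  have "card {A. A \<subseteq> insert e F \<and> has_cube S A}
      = card {A. A \<subseteq> F \<and> has_cube S A} + card {A. A \<subseteq> F \<and> has_cube S (insert e A)}"
    using insert.hyps by (rule card_subsets_insert)
  also have "\<dots> \<le> card {A. A \<subseteq> F \<and> has_cube ?S' A} + card {A. A \<subseteq> F \<and> has_cube ?S'' A}"
  proof (intro add_mono card_mono)
    show "{A. A \<subseteq> F \<and> has_cube S A} \<subseteq> {A. A \<subseteq> F \<and> has_cube ?S' A}"
      using insert.hyps by (auto intro: has_cube_trace)
    show "{A. A \<subseteq> F \<and> has_cube S (insert e A)} \<subseteq> {A. A \<subseteq> F \<and> has_cube ?S'' A}"
      using insert.hyps has_cube_insert_iff[of e _ S] by blast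
  qed (use insert.hyps in auto)
  also have "\<dots> \<le> card ?S' + card ?S''"
    using insert.prems by (intro add_mono insert.IH) auto
  also have "\<dots> = card S" using \<open>finite S\<close> by (rule card_family_split[symmetric])
  finally show ?case .
qed

text \<open>Equality for \<open>S\<close> forces equality in every estimate of the split at
  \<open>e\<close>. So the link is again extremal, and it shatters \<open>A - {e}\<close> because
  \<open>S\<close> shatters \<open>A\<close>; the cube of the link in these directions then extends
  by \<open>e\<close>.\<close>

lemma has_cube_if_card_eq:
  assumes "finite E" "S \<subseteq> Pow E" "card S = card {A. A \<subseteq> E \<and> shatters S A}"
    and "A \<subseteq> E" "shatters S A"
  shows "has_cube S A"
  using assms
proof (induction "card E" arbitrary: E S A rule: less_induct)
  case less
  show ?case
  proof (cases "A = {}")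
    case True
    then show ?thesis using less.prems(5) by (auto simp: shatters_def has_cube_def)
  next
    case False
    then obtain e where e: "e \<in> A" by blast
    let ?F = "E - {e}"
    let ?S' = "(\<lambda>T. T - {e}) ` S" and ?S'' = "{T \<in> S. e \<notin> T \<and> insert e T \<in> S}"
    have E: "E = insert e ?F" using e less.prems by auto
    have fin: "finite ?F" "finite S"
      using less.prems by (auto intro: finite_subset)
    have split: "card S = card ?S' + card ?S''" using fin(2) by (rule card_family_split)
    have "card ?S' \<le> card {A. A \<subseteq> ?F \<and> shatters ?S' A}"
      using fin less.prems by (intro card_le_card_shattered) auto
    also have "\<dots> \<le> card {A. A \<subseteq> ?F \<and> shatters S A}"
      using fin by (intro card_mono) (auto intro: shatters_trace)
    finally have le1: "card ?S' \<le> \<dots>" .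
    have le2: "card ?S'' \<le> card {A. A \<subseteq> ?F \<and> shatters ?S'' A}"
      using fin less.prems by (intro card_le_card_shattered) auto
    have sub: "{A. A \<subseteq> ?F \<and> shatters ?S'' A} \<subseteq> {A. A \<subseteq> ?F \<and> shatters S (insert e A)}"
      by (auto intro: shatters_insert)
    then have le3: "card {A. A \<subseteq> ?F \<and> shatters ?S'' A} \<le> card {A. A \<subseteq> ?F \<and> shatters S (insert e A)}"
      using fin by (intro card_mono) auto
    have "card S = card {A. A \<subseteq> ?F \<and> shatters S A} + card {A. A \<subseteq> ?F \<and> shatters S (insert e A)}"
      using less.prems(3) card_subsets_insert[OF fin(1), of e "shatters S"] E by simp
    then have eq: "card ?S'' = card {A. A \<subseteq> ?F \<and> shatters ?S'' A}"
      "card {A. A \<subseteq> ?F \<and> shatters ?S'' A} = card {A. A \<subseteq> ?F \<and> shatters S (insert e A)}"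
      using split le1 le2 le3 by linarith+
    have "{A. A \<subseteq> ?F \<and> shatters ?S'' A} = {A. A \<subseteq> ?F \<and> shatters S (insert e A)}"
      using fin by (intro card_subset_eq sub eq) auto
    moreover have "A - {e} \<in> {A. A \<subseteq> ?F \<and> shatters S (insert e A)}"
      using less.prems e by (auto simp: insert_absorb)
    ultimately have sh: "A - {e} \<subseteq> ?F" "shatters ?S'' (A - {e})" by auto
    have "has_cube ?S'' (A - {e})"
    proof (rule less.hyps[OF _ fin(1) _ eq(1) sh])
      show "card ?F < card E" using e less.prems by (intro psubset_card_mono) auto
    qed (use less.prems in auto)
    then have "has_cube S (insert e (A - {e}))"
      by (subst has_cube_insert_iff) auto
    then show ?thesis using e by (simp add: insert_absorb)
  qed
qed

section \<open>Faces and missing patterns of ample families\<close>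

lemma shattersD: "shatters S A \<Longrightarrow> B \<subseteq> A \<Longrightarrow> \<exists>T\<in>S. T \<inter> A = B"
  by (simp add: shatters_def)

lemma shatters_mono: "shatters S A \<Longrightarrow> S \<subseteq> S' \<Longrightarrow> shatters S' A"
  unfolding shatters_def by (meson subsetD)

lemma ample_cube: "ample S \<Longrightarrow> shatters S A \<Longrightarrow> \<exists>T. \<forall>B\<subseteq>A. (T - A) \<union> B \<in> S"
  by (simp add: ample_def has_cube_def)

text \<open>A cube of \<open>S\<close> in directions \<open>A\<close> may lie on the wrong side of
  \<open>e\<close>. Then, together with the members containing \<open>e\<close>, it makes
  \<open>S\<close> shatter \<open>insert e A\<close>, and the half of a cube in these directions
  that contains \<open>e\<close> is the one wanted.\<close>

lemma ample_mem:
  assumes "ample S"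
  shows "ample {T \<in> S. e \<in> T}"
  unfolding ample_def
proof (intro allI impI)
  fix A assume sh: "shatters {T \<in> S. e \<in> T} A"
  have "e \<notin> A" using shattersD[OF sh, of "{}"] by blast
  have "shatters S A" using sh by (rule shatters_mono) auto
  with assms obtain T where T: "\<And>B. B \<subseteq> A \<Longrightarrow> (T - A) \<union> B \<in> S"
    using ample_cube by blast
  show "has_cube {T \<in> S. e \<in> T} A"
  proof (cases "e \<in> T")
    case True
    then show ?thesis using T \<open>e \<notin> A\<close> unfolding has_cube_def by blast
  next
    case False
    have "shatters S (insert e A)"
      unfolding shatters_def
    proof (intro allI impI)
      fix B assume B: "B \<subseteq> insert e A"
      show "\<exists>T\<in>S. T \<inter> insert e A = B"
      proof (cases "e \<in> B")
        case True
        obtain T' where "T' \<in> S" "e \<in> T'" "T' \<inter> A = B - {e}"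
          using shattersD[OF sh, of "B - {e}"] B by blast
        then show ?thesis using True \<open>e \<notin> A\<close> B by (intro bexI[of _ T']) auto
      next
        case nB: False
        then show ?thesis using T[of B] False B by (intro bexI[of _ "(T - A) \<union> B"]) auto
      qed
    qed
    with assms obtain T2 where T2: "\<And>B. B \<subseteq> insert e A \<Longrightarrow> (T2 - insert e A) \<union> B \<in> S"
      using ample_cube by blast
    have "(insert e T2 - A) \<union> B \<in> {T \<in> S. e \<in> T}" if "B \<subseteq> A" for B
    proof -
      have "(insert e T2 - A) \<union> B = (T2 - insert e A) \<union> insert e B" using \<open>e \<notin> A\<close> by auto
      then show ?thesis using T2[of "insert e B"] that \<open>e \<notin> A\<close> by auto
    qed
    then show ?thesis unfolding has_cube_def by blast
  qed
qed

lemma ample_not_mem: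
  assumes "ample S"
  shows "ample {T \<in> S. e \<notin> T}"
  unfolding ample_def
proof (intro allI impI)
  fix A assume sh: "shatters {T \<in> S. e \<notin> T} A"
  have "e \<notin> A" using shattersD[OF sh, of A] by blast
  have "shatters S A" using sh by (rule shatters_mono) auto
  with assms obtain T where T: "\<And>B. B \<subseteq> A \<Longrightarrow> (T - A) \<union> B \<in> S"
    using ample_cube by blast
  show "has_cube {T \<in> S. e \<notin> T} A"
  proof (cases "e \<in> T")
    case False
    then show ?thesis using T \<open>e \<notin> A\<close> unfolding has_cube_def by blast
  next
    case True
    have "shatters S (insert e A)"
      unfolding shatters_def
    proof (intro allI impI)
      fix B assume B: "B \<subseteq> insert e A"
      show "\<exists>T\<in>S. T \<inter> insert e A = B"
      proof (cases "e \<in> B")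
        case False
        obtain T' where "T' \<in> S" "e \<notin> T'" "T' \<inter> A = B"
          using shattersD[OF sh, of B] B False by blast
        then show ?thesis using False \<open>e \<notin> A\<close> B by (intro bexI[of _ T']) auto
      next
        case eB: True
        then show ?thesis using T[of "B - {e}"] True B \<open>e \<notin> A\<close>
          by (intro bexI[of _ "(T - A) \<union> (B - {e})"]) auto
      qed
    qed
    with assms obtain T2 where T2: "\<And>B. B \<subseteq> insert e A \<Longrightarrow> (T2 - insert e A) \<union> B \<in> S"
      using ample_cube by blast
    have "((T2 - {e}) - A) \<union> B \<in> {T \<in> S. e \<notin> T}" if "B \<subseteq> A" for B
    proof -
      have "((T2 - {e}) - A) \<union> B = (T2 - insert e A) \<union> B" by auto
      then show ?thesis using T2[of B] that \<open>e \<notin> A\<close> by auto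
    qed
    then show ?thesis unfolding has_cube_def by blast
  qed
qed

lemma ample_face:
  assumes "ample S" "finite P" "finite N"
  shows "ample {T \<in> S. P \<subseteq> T \<and> N \<inter> T = {}}"
proof -
  have P: "ample {T \<in> S. P \<subseteq> T}"
    using assms(2,1)
  proof (induction P rule: finite_induct)
    case (insert e P)
    have "{T \<in> S. insert e P \<subseteq> T} = {T \<in> {T \<in> S. P \<subseteq> T}. e \<in> T}" by auto
    then show ?case using ample_mem[OF insert.IH[OF insert.prems], of e] by argo
  qed simp
  show ?thesis
    using assms(3)
  proof (induction N rule: finite_induct)
    case empty
    then show ?case using P by simp
  next
    case (insert e N)
    have "{T \<in> S. P \<subseteq> T \<and> insert e N \<inter> T = {}} = {T \<in> {T \<in> S. P \<subseteq> T \<and> N \<inter> T = {}}. e \<notin> T}"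
      by auto
    then show ?case using ample_not_mem[OF insert.IH, of e] by argo
  qed
qed

text \<open>Suppose \<open>Q\<close> is missing too and everything closer to \<open>Q0\<close> is
  present. Then the patterns between them shatter all differing coordinates but one,
  \<open>d\<close>; ampleness gives a cube with a constant value at \<open>d\<close>, and whichever
  value it is, the cube contains a member realising \<open>Q0\<close> or \<open>Q\<close>.\<close>

lemma ample_unique_missing:
  assumes S: "ample S" and "finite B" "Q0 \<subseteq> B"
    and missing: "\<And>T. T \<in> S \<Longrightarrow> T \<inter> B \<noteq> Q0"
    and minimal: "\<And>b. b \<in> B \<Longrightarrow> \<exists>T\<in>S. T \<inter> (B - {b}) = Q0 - {b}"
    and Q: "Q \<subseteq> B" "Q \<noteq> Q0"
  shows "\<exists>T\<in>S. T \<inter> B = Q"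
  using Q
proof (induction "card ((Q - Q0) \<union> (Q0 - Q))" arbitrary: Q rule: less_induct)
  case less
  let ?D = "(Q - Q0) \<union> (Q0 - Q)"
  show ?case
  proof (rule ccontr)
    assume Qm: "\<not> ?case"
    obtain d where d: "d \<in> ?D" using less.prems by blast
    have D: "?D \<subseteq> B" using less.prems \<open>Q0 \<subseteq> B\<close> by auto
    \<comment> \<open>The face on which members agree with \<open>Q0\<close> on
      \<open>B - ?D\<close>; on \<open>?D\<close> the patterns \<open>Q\<close> and
      \<open>Q0\<close> are antipodal.\<close>
    let ?F = "{T \<in> S. Q0 - ?D \<subseteq> T \<and> (B - ?D - Q0) \<inter> T = {}}"
    have "shatters ?F (?D - {d})"
      unfolding shatters_def
    proof (intro allI impI)
      fix R assume R: "R \<subseteq> ?D - {d}"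
      show "\<exists>T\<in>?F. T \<inter> (?D - {d}) = R"
      \<comment> \<open>The pattern of \<open>Q0\<close> comes from minimality at \<open>d\<close>;
        any other one, completed at \<open>d\<close> as in \<open>Q0\<close>, is closer to
        \<open>Q0\<close> than \<open>Q\<close> is.\<close>
      proof (cases "R = Q0 \<inter> (?D - {d})")
        case True
        obtain T where T: "T \<in> S" "T \<inter> (B - {d}) = Q0 - {d}"
          using minimal[of d] d D by blast
        then have "T \<in> ?F" using d by blast
        moreover have "T \<inter> (?D - {d}) = R" using True T(2) D by blast
        ultimately show ?thesis by blast
      next
        case False
        let ?Q = "(Q0 - ?D) \<union> R \<union> (Q0 \<inter> {d})"
        have "(?Q - Q0) \<union> (Q0 - ?Q) \<subset> ?D" using R d by blast
        then have "card ((?Q - Q0) \<union> (Q0 - ?Q)) < card ?D"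
          using D \<open>finite B\<close> by (intro psubset_card_mono) (auto intro: finite_subset)
        moreover have "?Q \<subseteq> B" using R D \<open>Q0 \<subseteq> B\<close> by blast
        moreover have "?Q \<noteq> Q0" using False R by blast
        ultimately obtain T where T: "T \<in> S" "T \<inter> B = ?Q" using less.hyps[of ?Q] by blast
        have "Q0 - ?D \<subseteq> T" using T(2) by blast
        moreover have "(B - ?D - Q0) \<inter> T = {}" using T(2) R by blast
        moreover have "T \<inter> (?D - {d}) = R"
        proof -
          have "T \<inter> (?D - {d}) = ?Q \<inter> (?D - {d})" using T(2) D by blast
          also have "\<dots> = R" using R by blast
          finally show ?thesis .
        qed
        ultimately show ?thesis using T(1) by blast
      qed
    qed
    moreover have "ample ?F"
      using S \<open>finite B\<close> \<open>Q0 \<subseteq> B\<close> by (intro ample_face) (auto intro: finite_subset)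
    ultimately have "\<exists>T. \<forall>R\<subseteq>?D - {d}. (T - (?D - {d})) \<union> R \<in> ?F"
      using ample_cube by blast
    then obtain T where T: "\<And>R. R \<subseteq> ?D - {d} \<Longrightarrow> (T - (?D - {d})) \<union> R \<in> ?F"
      by meson
    have inter: "T' \<inter> B = P" if "T' \<in> ?F" "T' \<inter> ?D = P \<inter> ?D" "P \<subseteq> B" "P - ?D = Q0 - ?D" for T' P
    proof -
      have "T' \<inter> (B - ?D) = Q0 - ?D" using that(1) \<open>Q0 \<subseteq> B\<close> by blast
      then have "T' \<inter> (B - ?D) = P - ?D" using that(4) by simp
      then show ?thesis using that(2,3) D by blast
    qed
    show False
    proof (cases "d \<in> T \<longleftrightarrow> d \<in> Q0")
      case True
      let ?T = "(T - (?D - {d})) \<union> (Q0 \<inter> (?D - {d}))"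
      have F: "?T \<in> ?F" by (rule T) blast
      have "?T \<inter> ?D = Q0 \<inter> ?D" using True d by blast
      then have "?T \<inter> B = Q0" by (rule inter[OF F]) (use \<open>Q0 \<subseteq> B\<close> in blast)+
      then show False using missing[OF CollectD[OF F, THEN conjunct1]] by contradiction
    next
      case False
      let ?T = "(T - (?D - {d})) \<union> (Q \<inter> (?D - {d}))"
      have F: "?T \<in> ?F" by (rule T) blast
      have "?T \<inter> ?D = Q \<inter> ?D" using False d by blast
      then have "?T \<inter> B = Q" by (rule inter[OF F]) (use less.prems(1) in blast)+
      then show False using Qm CollectD[OF F, THEN conjunct1] by metis
    qed
  qed
qed

subsection \<open>Tight separated collections and generic sign functions\<close>

context oriented_matroid_on
begin

lemma separated_collection_iff:
  "separated_collection E C S \<longleftrightarrow> S \<subseteq> Pow E \<and>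
     (\<forall>I\<in>S. \<forall>J\<in>S. \<forall>Y\<in>C. \<not> (orients_pos I Y \<and> orients_pos J (neg Y)))"
proof -
  have *: "fst Y \<subseteq> I - J \<and> snd Y \<subseteq> J - I \<longleftrightarrow> orients_pos I Y \<and> orients_pos J (neg Y)" for I J Y
    unfolding orients_pos_def neg_simps by blast
  show ?thesis unfolding separated_collection_def M_separated_def * by blast
qed

lemma shattered_in_Ind:
  assumes "separated_collection E C S" "shatters S A"
  shows "A \<in> Ind E C"
proof -
  have "A \<subseteq> E"
    using shattersD[OF assms(2), of A] assms(1) unfolding separated_collection_iff by blast
  moreover have False if "Y \<in> C" "supp Y \<subseteq> A" for Y
  proof -
    have "fst Y \<subseteq> A" "snd Y \<subseteq> A" using that by (auto simp: supp_def)
    then obtain I J where IJ: "I \<in> S" "I \<inter> A = fst Y" "J \<in> S" "J \<inter> A = snd Y"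
      using shattersD[OF assms(2)] by meson
    then have "orients_pos I Y" "orients_pos J (neg Y)"
      using that circuit_disjoint[OF that(1)] unfolding orients_pos_def supp_def by auto
    then show False using assms(1) IJ that unfolding separated_collection_iff by blast
  qed
  ultimately show ?thesis unfolding Ind_def by blast
qed

lemma finite_Ind: "finite (Ind E C)"
  by (rule finite_subset[of _ "Pow E"]) (auto simp: Ind_def finite_E)

lemma card_separated_le:
  assumes "separated_collection E C S"
  shows "card S \<le> card (Ind E C)"
proof -
  have "card S \<le> card {A. A \<subseteq> E \<and> shatters S A}"
    using assms by (intro card_le_card_shattered finite_E) (simp add: separated_collection_def)
  also have "\<dots> \<le> card (Ind E C)"
    by (rule card_mono[OF finite_Ind]) (use shattered_in_Ind[OF assms] in blast)
  finally show ?thesis .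
qed

text \<open>Tightness closes the chain \<open>card S\<close> \<le> number of shattered sets \<le>
  \<open>card (Ind E C)\<close>. Equality on the right identifies the shattered sets; on the left it
  is the equality case of Pajor's bound.\<close>

lemma separated_tight:
  assumes "separated_collection E C S" "card S = card (Ind E C)"
  shows "shatters S A \<longleftrightarrow> A \<in> Ind E C" and "ample S"
proof -
  have S: "S \<subseteq> Pow E" using assms(1) by (simp add: separated_collection_def)
  have le: "card S \<le> card {A. A \<subseteq> E \<and> shatters S A}"
    using S by (intro card_le_card_shattered finite_E)
  have sub: "{A. A \<subseteq> E \<and> shatters S A} \<subseteq> Ind E C" using shattered_in_Ind[OF assms(1)] by blast
  then have le': "card {A. A \<subseteq> E \<and> shatters S A} \<le> card (Ind E C)" by (rule card_mono[OF finite_Ind])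
  have "{A. A \<subseteq> E \<and> shatters S A} = Ind E C"
    using card_subset_eq[OF finite_Ind sub] le le' assms(2) by linarith
  then show iff: "shatters S A \<longleftrightarrow> A \<in> Ind E C" for A
    using shattered_in_Ind[OF assms(1)] by blast
  have "card S = card {A. A \<subseteq> E \<and> shatters S A}" using le le' assms(2) by linarith
  then show "ample S"
    unfolding ample_def using has_cube_if_card_eq[OF finite_E S] iff by (auto simp: Ind_def)
qed

lemma circuit_minus_Ind:
  assumes "Y \<in> C" "y \<in> supp Y"
  shows "supp Y - {y} \<in> Ind E C"
proof -
  have False if "Z \<in> C" "supp Z \<subseteq> supp Y - {y}" for Z
  proof -
    have "Z = Y \<or> Z = neg Y" using circuit_clutter[OF that(1) assms(1)] that(2) by blast
    then show False using that(2) assms(2) by auto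
  qed
  then show ?thesis using circuit_supp[OF assms(1)] unfolding Ind_def by blast
qed

text \<open>A circuit minus one element \<open>y\<close> is independent, so \<open>S\<close>
  contains a cube in these directions. Its constant value at \<open>y\<close> is the one prescribed
  by \<open>Y\<close> or by \<open>neg Y\<close>, and the other coordinates are free.\<close>

lemma tight_orients_circuit:
  assumes "separated_collection E C S" "card S = card (Ind E C)" "Y \<in> C"
  shows "\<exists>T\<in>S. orients_pos T Y \<or> orients_pos T (neg Y)"
proof -
  obtain y where y: "y \<in> supp Y" using circuit_nonempty[OF assms(3)] by blast
  note disj = circuit_disjoint[OF assms(3)]
  let ?D = "supp Y - {y}"
  have "shatters S ?D"
    using separated_tight(1)[OF assms(1,2)] circuit_minus_Ind[OF assms(3) y] by blast
  then obtain T where T: "\<And>B. B \<subseteq> ?D \<Longrightarrow> (T - ?D) \<union> B \<in> S"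
    using ample_cube[OF separated_tight(2)[OF assms(1,2)]] by blast
  show ?thesis
  proof (cases "y \<in> T \<longleftrightarrow> y \<in> fst Y")
    case True
    have "((T - ?D) \<union> (fst Y - {y})) \<inter> supp Y = fst Y"
      using True y by (auto simp: supp_def)
    then have "orients_pos ((T - ?D) \<union> (fst Y - {y})) Y"
      using disj by (subst orients_pos_iff)
    then show ?thesis using T[of "fst Y - {y}"] by (auto simp: supp_def)
  next
    case False
    have "((T - ?D) \<union> (snd Y - {y})) \<inter> supp (neg Y) = fst (neg Y)"
      using False y disj by (auto simp: supp_def)
    then have "orients_pos ((T - ?D) \<union> (snd Y - {y})) (neg Y)"
      using disj by (subst orients_pos_iff) auto
    then show ?thesis using T[of "snd Y - {y}"] by (auto simp: supp_def)
  qed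
qed

text \<open>Minimal missing patterns of a tight collection are circuits. By ampleness such a pattern
  is the only missing one on its support, so the support contains a circuit but its proper subsets
  are still shattered; a circuit on it other than the pattern and its negative would be oriented
  both ways.\<close>

lemma tight_missing_circuit:
  assumes S: "separated_collection E C S" "card S = card (Ind E C)"
    and X: "fst X \<inter> snd X = {}" "supp X \<subseteq> E" "\<And>T. T \<in> S \<Longrightarrow> \<not> orients_pos T X"
  shows "\<exists>Y\<in>C. Y \<sqsubseteq> X \<and> (\<forall>T\<in>S. \<not> orients_pos T Y)"
proof -
  define Q where "Q = (\<lambda>X'. X' \<sqsubseteq> X \<and> (\<forall>T\<in>S. \<not> orients_pos T X'))"
  have "Q X" using X(3) by (simp add: Q_def)
  then obtain X0 where X0: "Q X0" and least: "\<And>X'. Q X' \<Longrightarrow> card (supp X0) \<le> card (supp X')"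
    using ex_has_least_nat[of Q X "\<lambda>X. card (supp X)"] by blast
  let ?B = "supp X0"
  have disj: "fst X0 \<inter> snd X0 = {}" and "?B \<subseteq> E"
    using X0 X conformal_le_supp[of X0 X] by (auto simp: Q_def conformal_le_def)
  have "finite ?B" using \<open>?B \<subseteq> E\<close> finite_E finite_subset by blast
  have pattern: "\<exists>T\<in>S. T \<inter> ?B = R" if "R \<subseteq> ?B" "R \<noteq> fst X0" for R
  proof (rule ample_unique_missing[OF separated_tight(2)[OF S] \<open>finite ?B\<close>])
    show "T \<inter> ?B \<noteq> fst X0" if "T \<in> S" for T
      using X0 that disj by (auto simp: Q_def orients_pos_iff)
    show "\<exists>T\<in>S. T \<inter> (?B - {b}) = fst X0 - {b}" if b: "b \<in> ?B" for b
    proof -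
      let ?X = "(fst X0 - {b}, snd X0 - {b})"
      have B: "supp ?X = ?B - {b}" by (auto simp: supp_def)
      then have "card (supp ?X) < card ?B"
        using b \<open>finite ?B\<close> by (metis card_Diff1_less)
      then have "\<not> Q ?X" using least by fastforce
      moreover have "?X \<sqsubseteq> X" using X0 by (auto simp: Q_def conformal_le_def)
      ultimately obtain T where "T \<in> S" "orients_pos T ?X" by (auto simp: Q_def)
      then show ?thesis using disj B by (subst (asm) orients_pos_iff) auto
    qed
  qed (use that in \<open>auto simp: supp_def\<close>)
  have "\<not> shatters S ?B"
    using X0 disj by (auto simp: Q_def orients_pos_iff supp_def dest!: shattersD[of _ _ "fst X0"])
  then obtain Y where Y: "Y \<in> C" "supp Y \<subseteq> ?B"
    using separated_tight(1)[OF S] \<open>?B \<subseteq> E\<close> by (auto simp: Ind_def)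
  have YB: "supp Y = ?B"
  proof (rule ccontr)
    assume "supp Y \<noteq> ?B"
    then obtain b where b: "b \<in> ?B" "b \<notin> supp Y" using Y by blast
    have "shatters S (supp Y)"
      unfolding shatters_def
    proof (intro allI impI)
      fix R assume R: "R \<subseteq> supp Y"
      \<comment> \<open>A pattern on \<open>supp Y\<close> can be extended with either value at
        \<open>b\<close>, so the single missing pattern can be dodged.\<close>
      define R' where "R' = (if R = fst X0 then insert b R else R)"
      have "R' \<subseteq> ?B" "R' \<noteq> fst X0" using R b Y by (auto simp: R'_def)
      then obtain T where "T \<in> S" "T \<inter> ?B = R'" using pattern by blast
      moreover have "R' \<inter> supp Y = R" using R b by (auto simp: R'_def)
      ultimately have "T \<inter> supp Y = R" using Y by blast
      then show "\<exists>T\<in>S. T \<inter> supp Y = R" using \<open>T \<in> S\<close> by blast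
    qed
    then show False using separated_tight(1)[OF S] Y by (auto simp: Ind_def)
  qed
  note disjY = circuit_disjoint[OF Y(1)]
  have "fst Y = fst X0 \<or> snd Y = fst X0"
  proof (rule ccontr)
    assume *: "\<not> ?thesis"
    obtain I where "I \<in> S" "I \<inter> ?B = fst Y" using pattern[of "fst Y"] * YB by (auto simp: supp_def)
    moreover obtain J where "J \<in> S" "J \<inter> ?B = snd Y"
      using pattern[of "snd Y"] * YB by (auto simp: supp_def)
    ultimately have "I \<in> S" "J \<in> S" "orients_pos I Y" "orients_pos J (neg Y)"
      using disjY YB by (auto simp: orients_pos_iff Int_commute)
    then show False using S(1) Y(1) unfolding separated_collection_iff by blast
  qed
  then have "X0 = Y \<or> X0 = neg Y"
    using disj disjY YB unfolding supp_def by (auto simp: neg_def prod_eq_iff)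
  then show ?thesis using X0 Y(1) unfolding Q_def by (metis neg_circuit_iff)
qed

text \<open>The exceptional case \<open>X = neg Y\<close> of weak elimination cannot occur inside
  \<open>P\<close> by the second clause, so the closure condition is stated without
  exception.\<close>

definition generic :: "'a signed set \<Rightarrow> bool" where
  "generic P \<longleftrightarrow> P \<subseteq> C \<and> (\<forall>Y\<in>C. Y \<in> P \<longleftrightarrow> neg Y \<notin> P) \<and>
     (\<forall>X\<in>P. \<forall>Y\<in>P. \<forall>e\<in>sepr X Y. \<exists>Z\<in>P. Z \<sqsubseteq> elim X Y e)"

lemma genericD:
  assumes "generic P"
  shows "Y \<in> P \<Longrightarrow> Y \<in> C" "Y \<in> C \<Longrightarrow> neg Y \<in> P \<longleftrightarrow> Y \<notin> P"
    "X \<in> P \<Longrightarrow> Y \<in> P \<Longrightarrow> e \<in> sepr X Y \<Longrightarrow> \<exists>Z\<in>P. Z \<sqsubseteq> elim X Y e"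
  using assms unfolding generic_def by (blast+)

lemma tight_generic:
  assumes S: "separated_collection E C S" "card S = card (Ind E C)"
  shows "generic {Y \<in> C. \<exists>T\<in>S. orients_pos T Y}" (is "generic ?P")
proof -
  have half: "Y \<in> ?P \<longleftrightarrow> neg Y \<notin> ?P" if "Y \<in> C" for Y
    using tight_orients_circuit[OF S that] S(1) that unfolding separated_collection_iff by auto
  have elim: "\<exists>Z\<in>?P. Z \<sqsubseteq> elim X Y e"
    if X: "X \<in> ?P" and Y: "Y \<in> ?P" and e: "e \<in> fst X" "e \<in> snd Y" for X Y e
  proof (rule ccontr)
    assume no: "\<not> ?thesis"
    have XY: "X \<in> C" "Y \<in> C" using X Y by auto
    note disj = circuit_disjoint[OF XY(1)] circuit_disjoint[OF XY(2)]
    note sup = circuit_supp[OF XY(1)] circuit_supp[OF XY(2)]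
    let ?D = "sepr X Y - {e}"
    \<comment> \<open>The signs of \<open>elim X Y e\<close>, reversed at the elements without
      conflict. The conflicts other than \<open>e\<close> stay free, since the bound allows both
      signs there.\<close>
    let ?P = "snd X \<union> snd Y - sepr X Y" and ?N = "fst X \<union> fst Y - sepr X Y"
    let ?F = "{T \<in> S. ?P \<subseteq> T \<and> ?N \<inter> T = {}}"
    have "shatters ?F ?D"
      unfolding shatters_def
    proof (intro allI impI)
      fix R assume R: "R \<subseteq> ?D"
      define W where "W = (?P \<union> R, ?N \<union> (?D - R))"
      have W: "fst W \<inter> snd W = {}" "supp W \<subseteq> E"
        using R disj sup by (auto simp: W_def sepr_def supp_def)
      have "\<exists>T\<in>S. orients_pos T W"
      proof (rule ccontr)
        assume "\<not> ?thesis"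
        then obtain Z where Z: "Z \<in> C" "Z \<sqsubseteq> W" "\<forall>T\<in>S. \<not> orients_pos T Z"
          using tight_missing_circuit[OF S W] by blast
        \<comment> \<open>A missing circuit below \<open>W\<close> is oriented negatively, so its
          negative is a positive circuit, and the reversal of signs puts it below the bound.\<close>
        have "neg Z \<in> {Y \<in> C. \<exists>T\<in>S. orients_pos T Y}"
          using tight_orients_circuit[OF S Z(1)] Z by auto
        moreover have "neg Z \<sqsubseteq> elim X Y e"
          using Z(2) R e by (auto simp: W_def conformal_le_def elim_def sepr_def)
        ultimately show False using no by blast
      qed
      then obtain T where T: "T \<in> S" "orients_pos T W" by blast
      then have "T \<in> ?F" by (auto simp: orients_pos_def W_def)
      moreover have "T \<inter> ?D = R" using T(2) R by (auto simp: orients_pos_def W_def)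
      ultimately show "\<exists>T\<in>?F. T \<inter> ?D = R" by blast
    qed
    moreover have "ample ?F"
      using finite_supp[OF XY(1)] finite_supp[OF XY(2)]
      by (intro ample_face separated_tight(2)[OF S]) (auto simp: supp_def)
    ultimately obtain T where T: "\<forall>R\<subseteq>?D. (T - ?D) \<union> R \<in> ?F" using ample_cube by blast
    have missing: "\<not> orients_pos T' (neg X)" "\<not> orients_pos T' (neg Y)" if "T' \<in> S" for T'
      using X Y that S(1) XY unfolding separated_collection_iff by blast+
    show False
    \<comment> \<open>The value at \<open>e\<close> is constant on the cube. It agrees with
      \<open>neg Y\<close> or with \<open>neg X\<close>, whose signs on \<open>?D\<close> select a
      vertex orienting a positive circuit negatively.\<close>
    proof (cases "e \<in> T")
      case True
      let ?T = "(T - ?D) \<union> (snd Y \<inter> ?D)"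
      have F: "?T \<in> ?F" by (rule T[rule_format]) blast
      have "snd Y \<subseteq> ?T" using CollectD[OF F] True by blast
      moreover have "fst Y \<inter> ?T = {}" using CollectD[OF F] disj e by blast
      ultimately have "orients_pos ?T (neg Y)" by (simp add: orients_pos_def)
      then show False using missing(2)[OF CollectD[OF F, THEN conjunct1]] by contradiction
    next
      case False
      let ?T = "(T - ?D) \<union> (snd X \<inter> ?D)"
      have F: "?T \<in> ?F" by (rule T[rule_format]) blast
      have "snd X \<subseteq> ?T" using CollectD[OF F] disj e by blast
      moreover have "fst X \<inter> ?T = {}" using CollectD[OF F] disj False by blast
      ultimately have "orients_pos ?T (neg X)" by (simp add: orients_pos_def)
      then show False using missing(1)[OF CollectD[OF F, THEN conjunct1]] by contradiction
    qed
  qed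
  have "\<exists>Z\<in>?P. Z \<sqsubseteq> elim X Y e" if "X \<in> ?P" "Y \<in> ?P" "e \<in> sepr X Y" for X Y e
  proof (cases "e \<in> fst X \<and> e \<in> snd Y")
    case True
    then show ?thesis using elim[OF that(1,2)] by blast
  next
    case False
    then have "e \<in> fst Y" "e \<in> snd X" using that(3) by (auto simp: sepr_def)
    then show ?thesis using elim[OF that(2,1)] elim_commute[of X Y e] by simp
  qed
  then show ?thesis using half unfolding generic_def by blast
qed

text \<open>Strong elimination keeps the larger top element \<open>m\<close>, where weak elimination
  might lose it. This \<open>m\<close> is not a conflict: the other circuit either lacks
  \<open>m\<close> or has it as its own top, with sign \<open>+\<close>.\<close>

lemma ex_generic: "\<exists>P. generic P"
proof -
  obtain r :: "'a \<Rightarrow> nat" where r: "inj_on r E"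
    using finite_imp_inj_to_nat_seg[OF finite_E] by metis
  define top where "top = (\<lambda>m (Y :: 'a signed). m \<in> supp Y \<and> (\<forall>x\<in>supp Y. r x \<le> r m))"
  have top_ex: "\<exists>m. top m Y" if "Y \<in> C" for Y
  proof -
    have fin: "finite (r ` supp Y)" "r ` supp Y \<noteq> {}"
      using finite_supp[OF that] circuit_nonempty[OF that] by simp_all
    obtain m where "m \<in> supp Y" "Max (r ` supp Y) = r m" using Max_in[OF fin] by (rule imageE)
    then show ?thesis using Max_ge[OF fin(1)] by (auto simp: top_def)
  qed
  have top_unique: "m = m'" if "Y \<in> C" "top m Y" "top m' Y" for m m' Y
  proof (rule inj_onD[OF r])
    show "r m = r m'" using that(2,3) by (auto simp: top_def intro!: antisym)
    show "m \<in> E" "m' \<in> E" using that circuit_supp[OF that(1)] by (auto simp: top_def)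
  qed
  define P where "P = {Y \<in> C. \<exists>m. top m Y \<and> m \<in> fst Y}"
  have half: "Y \<in> P \<longleftrightarrow> neg Y \<notin> P" if Y: "Y \<in> C" for Y
  proof -
    obtain m where m: "top m Y" using top_ex[OF Y] by blast
    have top_neg: "top m' (neg Y) = top m' Y" for m' by (simp add: top_def)
    have "Y \<in> P \<longleftrightarrow> m \<in> fst Y" "neg Y \<in> P \<longleftrightarrow> m \<in> snd Y"
      using Y m top_unique[OF Y] by (auto simp: P_def top_neg)
    moreover have "m \<in> fst Y \<or> m \<in> snd Y" using m by (auto simp: top_def supp_def)
    ultimately show ?thesis using circuit_disjoint[OF Y] by blast
  qed
  have elim: "\<exists>Z\<in>P. Z \<sqsubseteq> elim X Y e"
    if P: "X \<in> P" "Y \<in> P" and e: "e \<in> sepr X Y"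
      and m: "top m X" "m \<in> fst X" and m': "top m' Y" "r m' \<le> r m" for X Y e m m'
  proof -
    have XY: "X \<in> C" "Y \<in> C" using P by (auto simp: P_def)
    note disj = circuit_disjoint[OF XY(1)] circuit_disjoint[OF XY(2)]
    have m'Y: "m' \<in> fst Y" using P(2) m'(1) top_unique[OF XY(2)] by (auto simp: P_def)
    have bound: "r x \<le> r m" if "x \<in> supp X \<union> supp Y" for x
    proof -
      have "r x \<le> r m \<or> r x \<le> r m'" using that m(1) m'(1) by (auto simp: top_def)
      then show ?thesis using m'(2) by linarith
    qed
    have mY: "m \<notin> snd Y"
    proof
      assume mY: "m \<in> snd Y"
      then have mm: "m \<in> supp Y" "m' \<in> supp Y" using m'(1) by (auto simp: supp_def top_def)
      then have "r m \<le> r m'" using m'(1) by (simp add: top_def)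
      then have "r m = r m'" using m'(2) by simp
      then have "m = m'" by (rule inj_onD[OF r]) (use mm circuit_supp[OF XY(2)] in auto)
      then show False using mY m'Y disj by blast
    qed
    then have msep: "m \<notin> sepr X Y" using m(2) disj(1) unfolding sepr_def by blast
    have "m \<in> supp X" using m(2) by (simp add: supp_def)
    then obtain Z where Z: "Z \<in> C" "Z \<sqsubseteq> elim X Y e" "m \<in> supp Z"
      using strong_elim[OF XY e _ msep] by blast
    have "supp Z \<subseteq> supp X \<union> supp Y"
      using Z(2) unfolding conformal_le_def elim_def supp_def by auto
    then have "top m Z" using Z(3) bound by (auto simp: top_def)
    moreover have "m \<in> fst Z"
      using Z(2,3) mY m(2) disj(1) unfolding conformal_le_def elim_def supp_def by auto
    ultimately show ?thesis using Z(1,2) unfolding P_def by blast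
  qed
  have elim': "\<exists>Z\<in>P. Z \<sqsubseteq> elim X Y e" if XY: "X \<in> P" "Y \<in> P" "e \<in> sepr X Y" for X Y e
  proof -
    obtain m m' where m: "top m X" "m \<in> fst X" "top m' Y" "m' \<in> fst Y"
      using XY(1,2) unfolding P_def by auto
    have "e \<in> sepr Y X" using XY(3) by (simp only: sepr_commute[of Y X])
    then show ?thesis
      using elim[OF XY m(1,2,3)] elim[OF XY(2,1) _ m(3,4,1)] elim_commute[of X Y e]
      by (cases "r m' \<le> r m") simp_all
  qed
  have "generic P"
    unfolding generic_def
  proof (intro conjI ballI)
    show "P \<subseteq> C" by (auto simp: P_def)
  qed (rule half elim', assumption+)+
  then show ?thesis by (rule exI)
qed

section \<open>The collection belonging to a generic set of circuits\<close>

definition sign_of :: "'a signed set \<Rightarrow> 'a signed \<Rightarrow> sign" where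
  "sign_of P Y = (if Y \<in> P then Pos else if neg Y \<in> P then Neg else Zero)"

text \<open>The form that \<open>S_of\<close> takes for a generic \<open>P\<close>: a negative
  orientation of \<open>Y\<close> is treated as a positive orientation of
  \<open>neg Y\<close>.\<close>

definition regions :: "'a signed set \<Rightarrow> 'a set set" where
  "regions P = {T. T \<subseteq> E \<and> (\<forall>Y\<in>C. orients_pos T Y \<longrightarrow> Y \<in> P)}"

lemma S_of_sign_of:
  assumes "generic P"
  shows "S_of E C (sign_of P) = regions P"
proof -
  have "(\<forall>Y\<in>C. (orients_pos T Y \<longrightarrow> sign_of P Y = Pos) \<and> (orients_neg T Y \<longrightarrow> sign_of P Y = Neg))
      \<longleftrightarrow> (\<forall>Y\<in>C. orients_pos T Y \<longrightarrow> Y \<in> P)" (is "?L \<longleftrightarrow> ?R") for T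
  proof
    show ?R if ?L using that by (fastforce simp: sign_of_def split: if_splits)
    show ?L if R: ?R
    proof (intro ballI conjI impI)
      fix Y assume Y: "Y \<in> C"
      show "sign_of P Y = Pos" if "orients_pos T Y" using that R Y by (simp add: sign_of_def)
      show "sign_of P Y = Neg" if "orients_neg T Y"
      proof -
        have "neg Y \<in> P" using that R Y by (simp add: orients_neg_iff)
        then show ?thesis using genericD(2)[OF assms Y] by (simp add: sign_of_def)
      qed
    qed
  qed
  then show ?thesis unfolding S_of_def regions_def by blast
qed

lemma separated_regions:
  assumes "generic P"
  shows "separated_collection E C (regions P)"
  unfolding separated_collection_iff regions_def
  using genericD(2)[OF assms] by auto

text \<open>Signs on \<open>I\<close> are left arbitrary, which later yields the cube. The choice at
  \<open>e\<close> cannot get stuck: if both values fail, the offending circuits have opposite signs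
  at \<open>e\<close>, and eliminating \<open>e\<close> from their negatives gives a circuit of
  \<open>P\<close> whose negative conforms to \<open>T\<close> on \<open>A\<close>, hence is in
  \<open>P\<close> as well.\<close>

lemma Ind_completion:
  assumes P: "generic P" and I: "I \<in> Ind E C" and A: "finite A" "A \<inter> I = {}"
  shows "\<exists>T\<subseteq>A. \<forall>Y\<in>C. supp Y \<subseteq> A \<union> I \<and> fst Y - I \<subseteq> T \<and> (snd Y - I) \<inter> T = {} \<longrightarrow> Y \<in> P"
  using A
proof (induction A rule: finite_induct)
  case empty
  then show ?case using I by (auto simp: Ind_def)
next
  case (insert e A)
  then obtain T where TA: "T \<subseteq> A" and T':
    "\<forall>Y\<in>C. supp Y \<subseteq> A \<union> I \<and> fst Y - I \<subseteq> T \<and> (snd Y - I) \<inter> T = {} \<longrightarrow> Y \<in> P"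
    by auto
  have T: "Y \<in> P" if "Y \<in> C" "supp Y \<subseteq> A \<union> I" "fst Y - I \<subseteq> T" "(snd Y - I) \<inter> T = {}" for Y
    using T' that by simp
  have eI: "e \<notin> I" "e \<notin> A" using insert by auto
  show ?case
  proof (rule ccontr)
    assume no: "\<not> ?case"
    have bad: "\<exists>Y\<in>C. supp Y \<subseteq> insert e A \<union> I \<and> fst Y - I \<subseteq> T' \<and> (snd Y - I) \<inter> T' = {} \<and> Y \<notin> P"
      if "T' \<subseteq> insert e A" for T'
      using no that by (simp add: Bex_def)
    have TT: "T \<subseteq> insert e A" "insert e T \<subseteq> insert e A" using TA by auto
    obtain X where X: "X \<in> C" "supp X \<subseteq> insert e A \<union> I" "fst X - I \<subseteq> T"
      "(snd X - I) \<inter> T = {}" "X \<notin> P" using bad[OF TT(1)] by blast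
    obtain Y where Y: "Y \<in> C" "supp Y \<subseteq> insert e A \<union> I" "fst Y - I \<subseteq> insert e T"
      "(snd Y - I) \<inter> insert e T = {}" "Y \<notin> P" using bad[OF TT(2)] by blast
    have "e \<in> supp X" using T[OF X(1) _ X(3,4)] X(2,5) by blast
    then have eX: "e \<in> snd X" using X(3) TA eI by (auto simp: supp_def)
    have eY: "e \<in> fst Y"
    proof (rule ccontr)
      assume nY: "e \<notin> fst Y"
      then have "e \<notin> supp Y" using Y(4) eI by (auto simp: supp_def)
      then have "supp Y \<subseteq> A \<union> I" "fst Y - I \<subseteq> T" "(snd Y - I) \<inter> T = {}"
        using Y(2,3,4) nY by auto
      then show False using T Y(1,5) by blast
    qed
    have "neg X \<in> P" "neg Y \<in> P" using genericD(2)[OF P] X Y by auto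
    moreover have "e \<in> sepr (neg X) (neg Y)" using eX eY by (auto simp: sepr_def)
    ultimately obtain Z where Z: "Z \<in> P" "Z \<sqsubseteq> elim (neg X) (neg Y) e"
      using genericD(3)[OF P] by blast
    have ZC: "Z \<in> C" using genericD(1)[OF P Z(1)] .
    have "neg Z \<in> P"
    proof (rule T)
      show "supp (neg Z) \<subseteq> A \<union> I"
        using Z(2) X(2) Y(2) by (auto simp: conformal_le_def elim_def supp_def)
      show "fst (neg Z) - I \<subseteq> T"
        using Z(2) X(3) Y(3) by (auto simp: conformal_le_def elim_def)
      show "(snd (neg Z) - I) \<inter> T = {}"
        using Z(2) X(4) Y(4) by (auto simp: conformal_le_def elim_def)
    qed (simp add: ZC)
    then show False using genericD(2)[OF P ZC] Z(1) by simp
  qed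
qed

lemma card_regions:
  assumes "generic P"
  shows "card (regions P) = card (Ind E C)"
proof -
  have "has_cube (regions P) I" if I: "I \<in> Ind E C" for I
  proof -
    have "finite (E - I)" "(E - I) \<inter> I = {}" "I \<subseteq> E" "E - I \<union> I = E"
      using finite_E I by (auto simp: Ind_def)
    then obtain T where T: "T \<subseteq> E - I"
      "\<And>Y. Y \<in> C \<Longrightarrow> fst Y - I \<subseteq> T \<Longrightarrow> (snd Y - I) \<inter> T = {} \<Longrightarrow> Y \<in> P"
      using Ind_completion[OF assms I] circuit_supp by metis
    have "(T - I) \<union> B \<in> regions P" if B: "B \<subseteq> I" for B
    proof -
      have "Y \<in> P" if "Y \<in> C" "orients_pos ((T - I) \<union> B) Y" for Y
        using that B T(1) by (intro T(2)) (auto simp: orients_pos_def)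
      then show ?thesis using B T(1) \<open>I \<subseteq> E\<close> by (auto simp: regions_def)
    qed
    then show ?thesis unfolding has_cube_def by blast
  qed
  then have "card (Ind E C) \<le> card {A. A \<subseteq> E \<and> has_cube (regions P) A}"
    by (intro card_mono) (auto simp: Ind_def finite_E)
  also have "\<dots> \<le> card (regions P)"
    by (rule card_cubes_le_card[OF finite_E]) (auto simp: regions_def)
  finally show ?thesis using card_separated_le[OF separated_regions[OF assms]] by simp
qed

text \<open>The bound is attained by \<open>regions P\<close> for the generic \<open>P\<close>
  supplied by \<open>ex_generic\<close>.\<close>

lemma max_by_size_iff:
  "max_by_size E C S \<longleftrightarrow> separated_collection E C S \<and> card S = card (Ind E C)"
  unfolding max_by_size_def
  using card_separated_le ex_generic card_regions separated_regions by (metis le_antisym)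

end

subsection \<open>One-element liftings\<close>

declare split_paired_All [simp del] split_paired_Ex [simp del]

fun neg_sign :: "sign \<Rightarrow> sign" where
  "neg_sign Pos = Neg" | "neg_sign Neg = Pos" | "neg_sign Zero = Zero"

section \<open>Signed sets on the ground set extended by \<open>g\<close>\<close>

lemma Some_mem_lift_signed [simp]:
  "Some x \<in> fst (lift_signed Y s) \<longleftrightarrow> x \<in> fst Y" "Some x \<in> snd (lift_signed Y s) \<longleftrightarrow> x \<in> snd Y"
  and None_mem_lift_signed [simp]:
  "None \<in> fst (lift_signed Y s) \<longleftrightarrow> s = Pos" "None \<in> snd (lift_signed Y s) \<longleftrightarrow> s = Neg"
  by (auto simp: lift_signed_def)

lemma restrict_lift_signed [simp]: "restrict_signed (lift_signed Y s) = Y"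
  by (simp add: restrict_signed_def vimage_def)

lemma neg_lift_signed: "neg (lift_signed Y s) = lift_signed (neg Y) (neg_sign s)"
  by (cases s) (simp_all add: neg_def lift_signed_def)

lemma lift_signed_eq_iff [simp]: "lift_signed Y s = lift_signed Y' s' \<longleftrightarrow> Y = Y' \<and> s = s'"
proof
  assume eq: "lift_signed Y s = lift_signed Y' s'"
  then have "Y = Y'" by (metis restrict_lift_signed)
  moreover have "s = Pos \<longleftrightarrow> s' = Pos" "s = Neg \<longleftrightarrow> s' = Neg"
    using None_mem_lift_signed[of Y s] None_mem_lift_signed[of Y' s'] eq by simp_all
  then have "s = s'" by (cases s; cases s') auto
  ultimately show "Y = Y' \<and> s = s'" ..
qed simp

lemma mem_supp_lift_signed [simp]:
  "Some x \<in> supp (lift_signed Y s) \<longleftrightarrow> x \<in> supp Y" "None \<in> supp (lift_signed Y s) \<longleftrightarrow> s \<noteq> Zero"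
  by (auto simp: supp_def) (metis sign.exhaust)

lemma subset_option_iff:
  "A \<subseteq> B \<longleftrightarrow> (\<forall>x. Some x \<in> A \<longrightarrow> Some x \<in> B) \<and> (None \<in> A \<longrightarrow> None \<in> B)"
  by (metis not_Some_eq subset_iff)

lemma supp_lift_signed_subset [simp]:
  "supp (lift_signed Y s) \<subseteq> supp (lift_signed Y' s') \<longleftrightarrow>
     supp Y \<subseteq> supp Y' \<and> (s \<noteq> Zero \<longrightarrow> s' \<noteq> Zero)"
  unfolding subset_option_iff[of "supp (lift_signed Y s)"] mem_supp_lift_signed by blast

lemma lift_signed_surj:
  assumes "fst X \<inter> snd X = {}"
  obtains s where "X = lift_signed (restrict_signed X) s"
proof
  let ?s = "if None \<in> fst X then Pos else if None \<in> snd X then Neg else Zero"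
  have "x \<in> fst X \<longleftrightarrow> x \<in> fst (lift_signed (restrict_signed X) ?s)"
    "x \<in> snd X \<longleftrightarrow> x \<in> snd (lift_signed (restrict_signed X) ?s)" for x
    using assms by (cases x; auto simp: restrict_signed_def)+
  then show "X = lift_signed (restrict_signed X) ?s" by (intro prod_eqI set_eqI) blast+
qed

text \<open>At \<open>g\<close> the bound offers zero and the signs \<open>a\<close> and
  \<open>b\<close>. If these are opposite, every \<open>s\<close> is allowed.\<close>

lemma lift_signed_le_elim_Some:
  "lift_signed Z s \<sqsubseteq> elim (lift_signed X a) (lift_signed Y b) (Some e) \<longleftrightarrow>
     Z \<sqsubseteq> elim X Y e \<and> (s \<noteq> Zero \<longrightarrow> s = a \<or> s = b)"
proof -
  have "fst (lift_signed Z s) \<subseteq> (fst (lift_signed X a) \<union> fst (lift_signed Y b)) - {Some e} \<longleftrightarrow>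
      fst Z \<subseteq> (fst X \<union> fst Y) - {e} \<and> (s = Pos \<longrightarrow> a = Pos \<or> b = Pos)"
    "snd (lift_signed Z s) \<subseteq> (snd (lift_signed X a) \<union> snd (lift_signed Y b)) - {Some e} \<longleftrightarrow>
      snd Z \<subseteq> (snd X \<union> snd Y) - {e} \<and> (s = Neg \<longrightarrow> a = Neg \<or> b = Neg)"
    by (auto simp: subset_option_iff[of "fst (lift_signed Z s)"]
        subset_option_iff[of "snd (lift_signed Z s)"])
  then show ?thesis unfolding conformal_le_def elim_def by (cases s) auto
qed

lemma lift_signed_le_elim_None:
  "lift_signed Z Zero \<sqsubseteq> elim (lift_signed X a) (lift_signed Y b) None \<longleftrightarrow>
     Z \<sqsubseteq> (fst X \<union> fst Y, snd X \<union> snd Y)"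
proof -
  have "fst (lift_signed Z Zero) \<subseteq> (fst (lift_signed X a) \<union> fst (lift_signed Y b)) - {None} \<longleftrightarrow>
      fst Z \<subseteq> fst X \<union> fst Y"
    "snd (lift_signed Z Zero) \<subseteq> (snd (lift_signed X a) \<union> snd (lift_signed Y b)) - {None} \<longleftrightarrow>
      snd Z \<subseteq> snd X \<union> snd Y"
    by (auto simp: subset_option_iff[of "fst (lift_signed Z Zero)"]
        subset_option_iff[of "snd (lift_signed Z Zero)"])
  then show ?thesis unfolding conformal_le_def elim_def by simp
qed

lemma oriented_matroidI:
  assumes "\<And>X. X \<in> C \<Longrightarrow> signed_subset_of E X" "\<And>X. X \<in> C \<Longrightarrow> supp X \<noteq> {}"
    "\<And>X. X \<in> C \<Longrightarrow> neg X \<in> C"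
    "\<And>X Y. X \<in> C \<Longrightarrow> Y \<in> C \<Longrightarrow> supp X \<subseteq> supp Y \<Longrightarrow> X = Y \<or> X = neg Y"
    "\<And>X Y e. X \<in> C \<Longrightarrow> Y \<in> C \<Longrightarrow> X \<noteq> neg Y \<Longrightarrow> e \<in> fst X \<Longrightarrow> e \<in> snd Y \<Longrightarrow>
      \<exists>Z\<in>C. Z \<sqsubseteq> elim X Y e"
  shows "oriented_matroid E C"
  unfolding oriented_matroid_def
proof (intro conjI ballI allI impI)
  fix X Y e assume "X \<in> C" "Y \<in> C" "X \<noteq> neg Y \<and> e \<in> fst X \<inter> snd Y"
  then show "\<exists>Z\<in>C. fst Z \<subseteq> fst X \<union> fst Y - {e} \<and> snd Z \<subseteq> snd X \<union> snd Y - {e}"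
    using assms(5)[of X Y e] by (simp add: conformal_le_def elim_def)
qed (use assms(1-4) in blast)+

context oriented_matroid_on
begin

text \<open>
  The circuits of the lifting that avoid \<open>g\<close> are the signed sets obtained by eliminating \<open>g\<close> from
  \<open>(W, +)\<close> and \<open>(V, -)\<close>.  They turn out to be the conformally minimal signed sets containing circuits
  of both signs.
\<close>
definition straddles :: "'a signed set \<Rightarrow> 'a signed \<Rightarrow> bool" where
  "straddles P X \<longleftrightarrow> fst X \<inter> snd X = {} \<and> supp X \<subseteq> E \<and>
     (\<exists>W\<in>P. W \<sqsubseteq> X) \<and> (\<exists>W\<in>P. neg W \<sqsubseteq> X)"

definition min_straddles :: "'a signed set \<Rightarrow> 'a signed \<Rightarrow> bool" where
  "min_straddles P X \<longleftrightarrow> straddles P X \<and> (\<forall>X'. straddles P X' \<and> X' \<sqsubseteq> X \<longrightarrow> X' = X)"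

lemma straddles_neg [simp]: "straddles P (neg X) \<longleftrightarrow> straddles P X"
  unfolding straddles_def neg_simps conformal_le_neg_left[symmetric] by (auto simp: Int_commute)

lemma min_straddles_neg [simp]: "min_straddles P (neg X) \<longleftrightarrow> min_straddles P X"
proof -
  have "min_straddles P (neg X)" if "min_straddles P X" for X
    using that unfolding min_straddles_def
    by (metis conformal_le_neg_left neg_eq_iff(2) straddles_neg)
  then show ?thesis by (metis neg_simps(3))
qed

lemma ex_min_straddles:
  assumes "straddles P X"
  shows "\<exists>X0. min_straddles P X0 \<and> X0 \<sqsubseteq> X"
proof -
  obtain X0 where X0: "straddles P X0 \<and> X0 \<sqsubseteq> X"
    and least: "\<And>X'. straddles P X' \<and> X' \<sqsubseteq> X \<Longrightarrow> card (supp X0) \<le> card (supp X')"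
    using ex_has_least_nat[of "\<lambda>X'. straddles P X' \<and> X' \<sqsubseteq> X" X "\<lambda>X. card (supp X)"]
      assms by auto
  have fin: "finite (supp X0)" using X0 finite_E by (auto simp: straddles_def intro: finite_subset)
  have "X' = X0" if "straddles P X'" "X' \<sqsubseteq> X0" for X'
  proof (rule conformal_le_supp_eq[OF that(2)])
    have "card (supp X0) \<le> card (supp X')" using least that X0 conformal_le_trans by blast
    then show "supp X0 \<subseteq> supp X'"
      using card_seteq[OF fin conformal_le_supp[OF that(2)]] by simp
  qed (use X0 in \<open>simp add: straddles_def\<close>)
  then have "min_straddles P X0" using X0 unfolding min_straddles_def by blast
  then show ?thesis using X0 by blast
qed

text \<open>\<open>G\<close> may carry both signs at an element, so the union of \<open>Z1\<close>
  and \<open>neg Z2\<close> may fail to be a signed set. Eliminating a conflict yields a circuit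
  below \<open>G\<close> that replaces \<open>Z1\<close> if it is in \<open>P\<close>, and
  \<open>neg Z2\<close> otherwise. Conflicts decrease, and the two circuits of \<open>P\<close> stay
  different because the eliminated element is gone.\<close>

lemma straddles_union:
  assumes P: "generic P" and "Z1 \<in> P" "Z2 \<in> P" "Z1 \<noteq> Z2" "Z1 \<sqsubseteq> G" "neg Z2 \<sqsubseteq> G"
  shows "\<exists>X. straddles P X \<and> X \<sqsubseteq> G"
  using assms(2-)
proof (induction "card (sepr Z1 (neg Z2))" arbitrary: Z1 Z2 rule: less_induct)
  case less
  note C = genericD(1)[OF P less.prems(1)] genericD(1)[OF P less.prems(2)]
  show ?case
  proof (cases "sepr Z1 (neg Z2) = {}")
    case True
    let ?X = "(fst Z1 \<union> snd Z2, snd Z1 \<union> fst Z2)"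
    have "straddles P ?X"
      unfolding straddles_def
    proof (intro conjI bexI)
      show "fst ?X \<inter> snd ?X = {}"
        using True circuit_disjoint[OF C(1)] circuit_disjoint[OF C(2)] by (auto simp: sepr_def)
      show "supp ?X \<subseteq> E" using circuit_supp[OF C(1)] circuit_supp[OF C(2)] by (auto simp: supp_def)
      show "Z1 \<sqsubseteq> ?X" "neg Z2 \<sqsubseteq> ?X" by (auto simp: conformal_le_def)
    qed (use less.prems in auto)
    moreover have "?X \<sqsubseteq> G" using less.prems by (auto simp: conformal_le_def)
    ultimately show ?thesis by blast
  next
    case False
    then obtain d where d: "d \<in> sepr Z1 (neg Z2)" by blast
    then have d': "d \<in> supp Z1" "d \<in> supp Z2" by (auto simp: sepr_def supp_def)
    obtain Z3 where Z3: "Z3 \<in> C" "Z3 \<sqsubseteq> elim Z1 (neg Z2) d"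
      using weak_elim[OF C(1) _ _ d] C(2) less.prems(3) by auto
    have fin: "finite (sepr Z1 (neg Z2))" by (rule finite_sepr[OF C(1)])
    have G: "Z3 \<sqsubseteq> G"
      using Z3(2) less.prems(4,5) by (auto simp: conformal_le_def elim_def)
    have dZ3: "d \<notin> supp Z3" using Z3(2) by (auto simp: conformal_le_def elim_def supp_def)
    show ?thesis
    proof (cases "Z3 \<in> P")
      case True
      have "sepr Z3 (neg Z2) \<subset> sepr Z1 (neg Z2)"
        using Z3(2) circuit_disjoint[OF C(2)] d
        by (auto simp: conformal_le_def elim_def sepr_def)
      then have "card (sepr Z3 (neg Z2)) < card (sepr Z1 (neg Z2))" by (rule psubset_card_mono[OF fin])
      moreover have "Z3 \<noteq> Z2" using dZ3 d' by blast
      ultimately show ?thesis using less.hyps[OF _ True less.prems(2)] less.prems(5) G by blast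
    next
      case False
      then have nZ3: "neg Z3 \<in> P" using genericD(2)[OF P Z3(1)] by simp
      have "sepr Z1 (neg (neg Z3)) \<subset> sepr Z1 (neg Z2)"
        using Z3(2) circuit_disjoint[OF C(1)] d
        by (auto simp: conformal_le_def elim_def sepr_def)
      then have "card (sepr Z1 (neg (neg Z3))) < card (sepr Z1 (neg Z2))" by (rule psubset_card_mono[OF fin])
      moreover have "Z1 \<noteq> neg Z3" using dZ3 d' by auto
      ultimately show ?thesis using less.hyps[OF _ less.prems(1) nZ3] less.prems(4) G by simp
    qed
  qed
qed

lemma generic_elim_below:
  assumes P: "generic P" and "W \<in> P" "V \<in> P" "W \<sqsubseteq> X" "V \<sqsubseteq> Y"
    and "fst X \<inter> snd X = {}" "fst Y \<inter> snd Y = {}" "e \<in> sepr X Y"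
  shows "\<exists>Z\<in>P. Z \<sqsubseteq> elim X Y e"
  using assms(4-)
proof (cases rule: sepr_cases)
  case 3
  then show ?thesis
    using genericD(3)[OF P assms(2,3)] elim_mono[OF assms(4,5)] conformal_le_trans by blast
qed (use assms in blast)+

lemma generic_elim_below_neg:
  assumes P: "generic P" and "W \<in> P" "V \<in> P" "neg W \<sqsubseteq> X" "neg V \<sqsubseteq> Y"
    and "fst X \<inter> snd X = {}" "fst Y \<inter> snd Y = {}" "e \<in> sepr X Y"
  shows "\<exists>Z\<in>P. neg Z \<sqsubseteq> elim X Y e"
proof -
  have "\<exists>Z\<in>P. Z \<sqsubseteq> elim (neg X) (neg Y) e"
    by (rule generic_elim_below[OF P assms(2,3)])
      (use assms in \<open>auto simp: conformal_le_neg_left Int_commute simp del: neg_simps(5)\<close>)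
  then show ?thesis by (simp add: conformal_le_neg_left)
qed

text \<open>Eliminating between positive circuits and between negative ones gives \<open>Z1\<close>
  and \<open>neg Z2\<close> below the bound, which suffice unless \<open>Z1 = Z2\<close>. In that
  case a further circuit below the bound is needed; the non-conflict \<open>u\<close>, covered by
  \<open>R\<close>, helps to provide one.\<close>

lemma straddles_elim:
  assumes P: "generic P" and X: "straddles P X" and Y: "straddles P Y" and e: "e \<in> sepr X Y"
    and R: "R \<in> C" "R \<sqsubseteq> X" and u: "u \<in> supp R" "u \<notin> sepr X Y"
  shows "\<exists>Z. straddles P Z \<and> Z \<sqsubseteq> elim X Y e"
proof -
  let ?G = "elim X Y e"
  have disj: "fst X \<inter> snd X = {}" "fst Y \<inter> snd Y = {}" using X Y by (auto simp: straddles_def)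
  obtain W1 W2 where W: "W1 \<in> P" "W1 \<sqsubseteq> X" "W2 \<in> P" "neg W2 \<sqsubseteq> X"
    using X by (auto simp: straddles_def)
  obtain V1 V2 where V: "V1 \<in> P" "V1 \<sqsubseteq> Y" "V2 \<in> P" "neg V2 \<sqsubseteq> Y"
    using Y by (auto simp: straddles_def)
  obtain Z1 where Z1: "Z1 \<in> P" "Z1 \<sqsubseteq> ?G" using generic_elim_below[OF P W(1) V(1) W(2) V(2) disj e] by blast
  obtain Z2 where Z2: "Z2 \<in> P" "neg Z2 \<sqsubseteq> ?G"
    using generic_elim_below_neg[OF P W(3) V(3) W(4) V(4) disj e] by blast
  show ?thesis
  proof (cases "Z1 = Z2")
    case False
    then show ?thesis using straddles_union[OF P Z1(1) Z2(1)] Z1 Z2 by blast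
  next
    case True
    \<comment> \<open>Both \<open>Z1\<close> and \<open>neg Z1\<close> lie below the bound, so it
      carries both signs on \<open>supp Z1\<close>, which is impossible at a non-conflict.\<close>
    have uZ: "u \<notin> supp Z1"
    proof
      assume "u \<in> supp Z1"
      then have "u \<in> fst ?G" "u \<in> snd ?G"
        using Z1(2) Z2(2) True by (auto simp: conformal_le_def supp_def)
      then show False using u(2) disj by (auto simp: elim_def sepr_def)
    qed
    \<comment> \<open>A circuit through \<open>u\<close> differs from \<open>Z1\<close> and
      \<open>neg Z1\<close>, so it pairs with one of them, whether or not it is in
      \<open>P\<close>.\<close>
    have Q_done: ?thesis if Q: "Q \<in> C" "Q \<sqsubseteq> ?G" "u \<in> supp Q" for Q
    proof (cases "Q \<in> P")
      case True
      then show ?thesis using straddles_union[OF P True Z2(1)] Q Z2 uZ \<open>Z1 = Z2\<close> by blast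
    next
      case False
      then have "neg Q \<in> P" using genericD(2)[OF P Q(1)] by simp
      moreover have "Z1 \<noteq> neg Q" using Q(3) uZ by auto
      ultimately show ?thesis using straddles_union[OF P Z1(1) _ _ Z1(2), of "neg Q"] Q by simp
    qed
    \<comment> \<open>Either \<open>R\<close> avoids \<open>e\<close>, or strong elimination between
      \<open>R\<close> and \<open>V\<close> keeps \<open>u\<close>, or \<open>V\<close> avoids
      \<open>e\<close> and lies below the bound. The last outcome for both \<open>V1\<close> and
      \<open>neg V2\<close> again gives a pair.\<close>
    have V_done: "?thesis \<or> V \<sqsubseteq> ?G" if V: "V \<in> C" "V \<sqsubseteq> Y" for V
      using R(2) V(2) disj e
    proof (cases rule: sepr_cases)
      case 1
      then show ?thesis using Q_done R u by blast
    next
      case 3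
      have "u \<notin> sepr R V" using u(2) sepr_mono[OF R(2) V(2)] by blast
      then obtain Q where "Q \<in> C" "Q \<sqsubseteq> elim R V e" "u \<in> supp Q"
        using strong_elim[OF R(1) V(1) 3(2) u(1)] by blast
      then show ?thesis using Q_done elim_mono[OF R(2) V(2)] conformal_le_trans by blast
    qed blast
    have VC: "V1 \<in> C" "neg V2 \<in> C" using V genericD(1)[OF P] by auto
    have "V1 \<noteq> V2"
    proof
      assume "V1 = V2"
      then have "supp V1 \<subseteq> fst Y \<inter> snd Y" using V(2,4) by (auto simp: conformal_le_def supp_def)
      then show False using disj circuit_nonempty[OF VC(1)] by auto
    qed
    then show ?thesis
      using V_done[OF VC(1) V(2)] V_done[OF VC(2) V(4)] straddles_union[OF P V(1,3)] by blast
  qed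
qed

text \<open>The union of any \<open>W\<close> and \<open>neg V\<close> witnessing that
  \<open>X\<close> straddles also straddles, so by minimality it is \<open>X\<close>. This supplies
  the circuit \<open>R\<close> demanded by \<open>straddles_elim\<close>.\<close>

lemma min_straddles_covered:
  assumes P: "generic P" and X: "min_straddles P X" and u: "u \<in> supp X"
  shows "\<exists>R\<in>C. R \<sqsubseteq> X \<and> u \<in> supp R"
proof -
  obtain W V where W: "W \<in> P" "W \<sqsubseteq> X" "V \<in> P" "neg V \<sqsubseteq> X"
    using X by (auto simp: straddles_def min_straddles_def)
  let ?X = "(fst W \<union> snd V, snd W \<union> fst V)"
  have "?X \<sqsubseteq> X" using W by (auto simp: conformal_le_def)
  moreover have "straddles P ?X"
    unfolding straddles_def
  proof (intro conjI bexI)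
    show "fst ?X \<inter> snd ?X = {}" "supp ?X \<subseteq> E"
      using \<open>?X \<sqsubseteq> X\<close> X conformal_le_supp[OF \<open>?X \<sqsubseteq> X\<close>]
      by (auto simp: min_straddles_def straddles_def conformal_le_def)
    show "W \<sqsubseteq> ?X" "neg V \<sqsubseteq> ?X" by (auto simp: conformal_le_def)
  qed (use W in auto)
  ultimately have "?X = X" using X by (auto simp: min_straddles_def)
  then have "supp X = supp W \<union> supp (neg V)" by (auto simp: supp_def)
  moreover have "W \<in> C" "neg V \<in> C" using W genericD(1)[OF P] by auto
  ultimately show ?thesis using u W by blast
qed

text \<open>Minimality is conformal, while the clutter axiom compares supports. If some but not all
  elements of \<open>X\<close> conflict with \<open>Y\<close>, an elimination gives a straddling set
  inside \<open>supp Y\<close> that misses an element of it and has fewer conflicts with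
  \<open>Y\<close>, which the induction refutes.\<close>

lemma min_straddles_clutter:
  assumes P: "generic P" and "straddles P X" "min_straddles P Y" "supp X \<subseteq> supp Y"
  shows "X = Y \<or> X = neg Y"
  using assms(2-)
proof (induction "card (sepr X Y)" arbitrary: X rule: less_induct)
  case less
  have Y: "straddles P Y" "fst Y \<inter> snd Y = {}" "supp Y \<subseteq> E"
    using less.prems(2) by (auto simp: min_straddles_def straddles_def)
  have min: "X' = Y" if "straddles P X'" "X' \<sqsubseteq> Y" for X'
    using that less.prems(2) unfolding min_straddles_def by blast
  consider "sepr X Y = {}" | "supp X \<subseteq> sepr X Y" | e u where "e \<in> sepr X Y" "u \<in> supp X" "u \<notin> sepr X Y"
    by blast
  then show ?case
  proof cases
    case 1
    then have "X \<sqsubseteq> Y" using less.prems(3) by (auto simp: conformal_le_def sepr_def supp_def)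
    then show ?thesis using min less.prems(1) by blast
  next
    case 2
    have "fst X \<inter> snd X = {}" using less.prems(1) by (simp add: straddles_def)
    with 2 have "neg X \<sqsubseteq> Y" by (auto simp: conformal_le_def sepr_def supp_def)
    then show ?thesis using min[of "neg X"] less.prems(1) by auto
  next
    case 3
    then obtain R where "R \<in> C" "R \<sqsubseteq> Y" "u \<in> supp R"
      using min_straddles_covered[OF P less.prems(2)] less.prems(3) by blast
    then obtain Z where Z: "straddles P Z" "Z \<sqsubseteq> elim Y X e"
      using straddles_elim[OF P Y(1) less.prems(1)] 3 sepr_commute by metis
    have "sepr Z Y \<subset> sepr X Y"
      using Z(2) Y(2) 3(1) by (auto simp: conformal_le_def elim_def sepr_def)
    moreover have "finite (sepr X Y)"
      using Y(3) finite_E by (auto simp: sepr_def supp_def intro: finite_subset)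
    ultimately have "card (sepr Z Y) < card (sepr X Y)" by (rule psubset_card_mono[rotated])
    moreover have Zs: "supp Z \<subseteq> supp Y" "e \<notin> supp Z"
      using Z(2) less.prems(3) by (auto simp: conformal_le_def elim_def supp_def)
    ultimately have "Z = Y \<or> Z = neg Y" using less.hyps Z(1) less.prems(2) by blast
    moreover have "e \<in> supp Y" using 3(1) by (auto simp: sepr_def supp_def)
    ultimately show ?thesis using Zs(2) by auto
  qed
qed

lemma sign_of_generic:
  assumes P: "generic P"
  shows "sign_of P Y = Pos \<longleftrightarrow> Y \<in> P" "sign_of P Y = Neg \<longleftrightarrow> neg Y \<in> P"
    "sign_of P (neg Y) = neg_sign (sign_of P Y)" "Y \<in> C \<Longrightarrow> sign_of P Y \<noteq> Zero"
    "Y \<notin> C \<Longrightarrow> sign_of P Y = Zero"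
proof -
  have not_both: "neg Y \<notin> P" if "Y \<in> P"
    using that genericD(1)[OF P that] genericD(2)[OF P] by simp
  then show "sign_of P Y = Pos \<longleftrightarrow> Y \<in> P" "sign_of P Y = Neg \<longleftrightarrow> neg Y \<in> P"
    "sign_of P (neg Y) = neg_sign (sign_of P Y)"
    by (auto simp: sign_of_def)
  show "sign_of P Y \<noteq> Zero" if "Y \<in> C"
    using genericD(2)[OF P that] by (auto simp: sign_of_def)
  show "sign_of P Y = Zero" if "Y \<notin> C"
    using that genericD(1)[OF P, of Y] genericD(1)[OF P, of "neg Y"] by (auto simp: sign_of_def)
qed

section \<open>The lifting built from a generic set\<close>

definition lifted_circuits :: "'a signed set \<Rightarrow> 'a option signed set" where
  "lifted_circuits P =
     {lift_signed Y s | Y s. Y \<in> C \<and> s = sign_of P Y \<or> min_straddles P Y \<and> s = Zero}"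

lemma lift_mem_lifted_circuits:
  "lift_signed Y s \<in> lifted_circuits P \<longleftrightarrow> Y \<in> C \<and> s = sign_of P Y \<or> min_straddles P Y \<and> s = Zero"
  by (auto simp: lifted_circuits_def)

text \<open>Two circuits of \<open>P\<close> inside \<open>supp Y\<close> coincide by the clutter
  axiom, and a circuit cannot lie below a signed set together with its negative.\<close>

lemma straddles_not_le_circuit:
  assumes P: "generic P" and "straddles P X" "Y \<in> C"
  shows "\<not> supp X \<subseteq> supp Y"
proof
  assume sub: "supp X \<subseteq> supp Y"
  obtain W V where W: "W \<in> P" "W \<sqsubseteq> X" "V \<in> P" "neg V \<sqsubseteq> X"
    using assms(2) by (auto simp: straddles_def)
  have C: "W \<in> C" "V \<in> C" using W genericD(1)[OF P] by auto
  have WV: "supp W \<subseteq> supp X" "supp V \<subseteq> supp X"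
    using conformal_le_supp[OF W(2)] conformal_le_supp[OF W(4)] by auto
  have "W = Y \<or> W = neg Y" "V = Y \<or> V = neg Y"
    using circuit_clutter[OF C(1) assms(3)] circuit_clutter[OF C(2) assms(3)] WV sub by blast+
  then have "V = W \<or> V = neg W" by auto
  moreover have "V \<noteq> neg W" using W(1,3) genericD(2)[OF P C(1)] by auto
  ultimately have "supp W \<subseteq> fst X \<inter> snd X" using W(2,4) by (auto simp: conformal_le_def supp_def)
  then show False using assms(2) circuit_nonempty[OF C(1)] by (auto simp: straddles_def)
qed

text \<open>This removes the circuits avoiding \<open>g\<close> from the contraction, where only
  minimal supports survive.\<close>

lemma circuit_inside_min_straddles:
  assumes P: "generic P" and X: "min_straddles P X"
  shows "\<exists>W\<in>C. supp W \<subset> supp X"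
proof (rule ccontr)
  assume no: "\<not> ?thesis"
  obtain W where W: "W \<in> P" "W \<sqsubseteq> X" using X by (auto simp: min_straddles_def straddles_def)
  then have "W \<in> C" using genericD(1)[OF P] by blast
  then have "supp W = supp X" using no conformal_le_supp[OF W(2)] by blast
  moreover have "straddles P X" using X by (simp add: min_straddles_def)
  ultimately show False using straddles_not_le_circuit[OF P _ \<open>W \<in> C\<close>] by blast
qed

text \<open>Elimination at \<open>g\<close> combines circuits of both signs into a straddling set.
  Elsewhere the sign at \<open>g\<close> is the issue: for equal nonzero signs closure of
  \<open>P\<close> supplies it, for opposite signs any circuit fits, and a side with value zero
  contains circuits of both signs, so it adapts to the other side. Two zeros are the case of
  \<open>straddles_elim\<close>.\<close>

lemma lifted_circuits_elim:
  assumes P: "generic P" and A: "lift_signed A a \<in> lifted_circuits P"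
    and B: "lift_signed B b \<in> lifted_circuits P"
    and neq: "lift_signed A a \<noteq> neg (lift_signed B b)"
    and e: "e \<in> fst (lift_signed A a)" "e \<in> snd (lift_signed B b)"
  shows "\<exists>Z\<in>lifted_circuits P. Z \<sqsubseteq> elim (lift_signed A a) (lift_signed B b) e"
proof (cases e)
  case None
  then have ab: "a = Pos" "b = Neg" using e by auto
  then have AB: "A \<in> P" "neg B \<in> P"
    using A B sign_of_generic(1)[OF P, of A] sign_of_generic(2)[OF P, of B]
    by (auto simp: lift_mem_lifted_circuits)
  have "A \<noteq> neg B" using neq ab by (auto simp: neg_lift_signed)
  then obtain X where "straddles P X" "X \<sqsubseteq> (fst A \<union> fst B, snd A \<union> snd B)"
    using straddles_union[OF P AB, of "(fst A \<union> fst B, snd A \<union> snd B)"]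
    by (auto simp: conformal_le_def)
  then obtain X0 where "min_straddles P X0" "X0 \<sqsubseteq> (fst A \<union> fst B, snd A \<union> snd B)"
    using ex_min_straddles conformal_le_trans by blast
  then show ?thesis
    using None lift_signed_le_elim_None[of X0 A a B b] lift_mem_lifted_circuits[of X0 Zero P] by blast
next
  case (Some x)
  have x: "x \<in> sepr A B" using e Some by (auto simp: sepr_def)
  have x': "x \<in> sepr B A" using x by (simp add: sepr_commute)
  have done_pos: ?thesis if Z: "Z \<in> P" "Z \<sqsubseteq> elim A B x" and ab: "Pos = a \<or> Pos = b" for Z
  proof -
    have "lift_signed Z Pos \<in> lifted_circuits P"
      using Z(1) genericD(1)[OF P Z(1)] sign_of_generic(1)[OF P, of Z]
      by (simp add: lift_mem_lifted_circuits)
    then show ?thesis using Some Z(2) ab lift_signed_le_elim_Some[of Z Pos A a B b x] by blast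
  qed
  have done_neg: ?thesis if Z: "Z \<in> P" "neg Z \<sqsubseteq> elim A B x" and ab: "Neg = a \<or> Neg = b" for Z
  proof -
    have "lift_signed (neg Z) Neg \<in> lifted_circuits P"
      using Z(1) genericD(1)[OF P Z(1)] sign_of_generic(2)[OF P, of "neg Z"]
      by (simp add: lift_mem_lifted_circuits)
    then show ?thesis using Some Z(2) ab lift_signed_le_elim_Some[of "neg Z" Neg A a B b x] by blast
  qed
  have done_zero: ?thesis if Z: "straddles P Z" "Z \<sqsubseteq> elim A B x" for Z
  proof -
    obtain Z0 where Z0: "min_straddles P Z0" "Z0 \<sqsubseteq> elim A B x"
      using ex_min_straddles Z conformal_le_trans by blast
    then have "lift_signed Z0 Zero \<in> lifted_circuits P" by (simp add: lift_mem_lifted_circuits)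
    then show ?thesis using Some Z0 lift_signed_le_elim_Some[of Z0 Zero A a B b x] by blast
  qed
  have one_side: "(c = Pos \<and> (\<exists>W\<in>P. W \<sqsubseteq> X)) \<or> (c = Neg \<and> (\<exists>W\<in>P. neg W \<sqsubseteq> X))"
    if X: "X \<in> C" "c = sign_of P X" for X c
  proof (cases "X \<in> P")
    case True
    then show ?thesis using X(2) sign_of_generic(1)[OF P, of X] conformal_le_refl by blast
  next
    case False
    then have "neg X \<in> P" using genericD(2)[OF P X(1)] by simp
    moreover have "neg (neg X) \<sqsubseteq> X" by simp
    ultimately show ?thesis using X(2) sign_of_generic(2)[OF P, of X] by blast
  qed
  have dA: "fst A \<inter> snd A = {}" and dB: "fst B \<inter> snd B = {}"
    using A B circuit_disjoint[of A] circuit_disjoint[of B]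
    unfolding lift_mem_lifted_circuits min_straddles_def straddles_def by blast+
  have pos: ?thesis if "\<exists>W\<in>P. W \<sqsubseteq> A" "\<exists>W\<in>P. W \<sqsubseteq> B" "Pos = a \<or> Pos = b"
    using that done_pos generic_elim_below[OF P _ _ _ _ dA dB x] by blast
  have neg: ?thesis if "\<exists>W\<in>P. neg W \<sqsubseteq> A" "\<exists>W\<in>P. neg W \<sqsubseteq> B" "Neg = a \<or> Neg = b"
    using that done_neg generic_elim_below_neg[OF P _ _ _ _ dA dB x] by blast
  consider (CC) "A \<in> C" "a = sign_of P A" "B \<in> C" "b = sign_of P B"
    | (CM) "A \<in> C" "a = sign_of P A" "min_straddles P B"
    | (MC) "min_straddles P A" "B \<in> C" "b = sign_of P B"
    | (MM) "min_straddles P A" "a = Zero" "min_straddles P B" "b = Zero"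
    using A B by (auto simp: lift_mem_lifted_circuits)
  then show ?thesis
  proof cases
    case CC
    show ?thesis
    proof (cases "a = b")
      case True
      then show ?thesis
        using one_side[OF CC(1,2)] one_side[OF CC(3,4)] pos neg by auto
    next
      case False
      have "A \<noteq> neg B" using neq CC sign_of_generic(3)[OF P] by (auto simp: neg_lift_signed)
      then obtain Z where Z: "Z \<in> C" "Z \<sqsubseteq> elim A B x" using weak_elim CC(1,3) x by blast
      have ab: "Pos = a \<or> Pos = b" "Neg = a \<or> Neg = b"
        using one_side[OF CC(1,2)] one_side[OF CC(3,4)] False by auto
      show ?thesis
      proof (cases "Z \<in> P")
        case True
        then show ?thesis using done_pos Z ab by blast
      next
        case False
        then have "neg Z \<in> P" using genericD(2)[OF P Z(1)] by simp
        then show ?thesis using done_neg[of "neg Z"] Z ab by simp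
      qed
    qed
  next
    case CM
    then have "\<exists>W\<in>P. W \<sqsubseteq> B" "\<exists>W\<in>P. neg W \<sqsubseteq> B" by (auto simp: min_straddles_def straddles_def)
    then show ?thesis using one_side[OF CM(1,2)] pos neg by auto
  next
    case MC
    then have "\<exists>W\<in>P. W \<sqsubseteq> A" "\<exists>W\<in>P. neg W \<sqsubseteq> A" by (auto simp: min_straddles_def straddles_def)
    then show ?thesis using one_side[OF MC(2,3)] pos neg by auto
  next
    case MM
    have AB: "straddles P A" "straddles P B" using MM by (auto simp: min_straddles_def)
    have "\<exists>u\<in>supp A \<union> supp B. u \<notin> sepr A B"
    proof (rule ccontr)
      assume "\<not> ?thesis"
      then have "A = neg B"
        using dA dB by (intro prod_eqI) (auto simp: sepr_def supp_def)
      then show False using neq MM by (simp add: neg_lift_signed)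
    qed
    then obtain u where u: "u \<in> supp A \<union> supp B" "u \<notin> sepr A B" by blast
    show ?thesis
    proof (cases "u \<in> supp A")
      case True
      then obtain R where "R \<in> C" "R \<sqsubseteq> A" "u \<in> supp R" using min_straddles_covered[OF P MM(1)] by blast
      then show ?thesis using straddles_elim[OF P AB x _ _ _ u(2)] done_zero by blast
    next
      case False
      then obtain R where R: "R \<in> C" "R \<sqsubseteq> B" "u \<in> supp R"
        using min_straddles_covered[OF P MM(3)] u(1) by blast
      have "u \<notin> sepr B A" using u(2) by (simp add: sepr_commute)
      then obtain Z where "straddles P Z" "Z \<sqsubseteq> elim B A x"
        using straddles_elim[OF P AB(2,1) x' R] by blast
      then show ?thesis using done_zero by (simp add: elim_commute[of B A])
    qed
  qed
qed

lemma oriented_matroid_lifted_circuits: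
  assumes P: "generic P"
  shows "oriented_matroid (insert None (Some ` E)) (lifted_circuits P)"
proof (rule oriented_matroidI)
  have cases: thesis
    if "X \<in> lifted_circuits P"
      "\<And>Y. X = lift_signed Y (sign_of P Y) \<Longrightarrow> Y \<in> C \<Longrightarrow> sign_of P Y \<noteq> Zero \<Longrightarrow> thesis"
      "\<And>Y. X = lift_signed Y Zero \<Longrightarrow> min_straddles P Y \<Longrightarrow> straddles P Y \<Longrightarrow> thesis" for X thesis
    using that sign_of_generic(4)[OF P] unfolding lifted_circuits_def min_straddles_def by blast
  fix X assume X: "X \<in> lifted_circuits P"
  obtain A a where A: "X = lift_signed A a" "fst A \<inter> snd A = {}" "supp A \<subseteq> E" "supp A \<noteq> {}"
  proof (rule cases[OF X])
    fix Y assume "X = lift_signed Y (sign_of P Y)" "Y \<in> C"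
    then show thesis using that circuit_disjoint circuit_supp circuit_nonempty by blast
  next
    fix Y assume Y: "X = lift_signed Y Zero" "straddles P Y"
    then obtain W where "W \<in> P" "W \<sqsubseteq> Y" by (auto simp: straddles_def)
    then have "supp Y \<noteq> {}"
      using circuit_nonempty[OF genericD(1)[OF P]] conformal_le_supp[of W Y] by blast
    then show thesis using that Y by (auto simp: straddles_def)
  qed
  show "signed_subset_of (insert None (Some ` E)) X"
  proof -
    have "x \<notin> fst X \<or> x \<notin> snd X" for x using A(1,2) by (cases x) auto
    moreover have "x \<in> insert None (Some ` E)" if "x \<in> supp X" for x
      using A(1,3) that by (cases x) auto
    ultimately show ?thesis unfolding signed_subset_of_def by blast
  qed
  show "supp X \<noteq> {}"
  proof -
    obtain x where "x \<in> supp A" using A(4) by blast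
    then have "Some x \<in> supp X" using A(1) by simp
    then show ?thesis by blast
  qed
  show "neg X \<in> lifted_circuits P"
    by (rule cases[OF X]) (simp_all add: neg_lift_signed lift_mem_lifted_circuits sign_of_generic(3)[OF P])
  fix Y assume Y: "Y \<in> lifted_circuits P"
  show "X = Y \<or> X = neg Y" if sub: "supp X \<subseteq> supp Y"
  proof (rule cases[OF X]; rule cases[OF Y])
    fix A B assume "X = lift_signed A (sign_of P A)" "Y = lift_signed B (sign_of P B)" "A \<in> C" "B \<in> C"
    then show ?thesis
      using sub circuit_clutter[of A B] sign_of_generic(3)[OF P, of B] by (auto simp: neg_lift_signed)
  next
    fix A B assume "X = lift_signed A (sign_of P A)" "sign_of P A \<noteq> Zero" "Y = lift_signed B Zero"
    then show ?thesis using sub by simp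
  next
    fix A B assume "X = lift_signed A Zero" "straddles P A" "Y = lift_signed B (sign_of P B)" "B \<in> C"
    then show ?thesis using sub straddles_not_le_circuit[OF P] by simp
  next
    fix A B assume "X = lift_signed A Zero" "straddles P A" "Y = lift_signed B Zero" "min_straddles P B"
    then show ?thesis using sub min_straddles_clutter[OF P] by (auto simp: neg_lift_signed)
  qed
  show "\<exists>Z\<in>lifted_circuits P. Z \<sqsubseteq> elim X Y e"
    if "X \<noteq> neg Y" "e \<in> fst X" "e \<in> snd Y" for e
  proof -
    obtain B b where "Y = lift_signed B b" using Y by (auto simp: lifted_circuits_def)
    then show ?thesis using lifted_circuits_elim[OF P, of A a B b e] X Y A(1) that by simp
  qed
qed

lemma contract_lifted_circuits:
  assumes P: "generic P"
  shows "contract_g (lifted_circuits P) = C"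
proof -
  have image: "restrict_signed ` lifted_circuits P = C \<union> {X. min_straddles P X}"
  proof (intro equalityI subsetI)
    fix X assume "X \<in> C \<union> {X. min_straddles P X}"
    then have "\<exists>s. lift_signed X s \<in> lifted_circuits P" by (auto simp: lift_mem_lifted_circuits)
    then show "X \<in> restrict_signed ` lifted_circuits P" by (metis imageI restrict_lift_signed)
  qed (auto simp: lifted_circuits_def)
  show ?thesis
  proof (intro equalityI subsetI)
    fix X assume X: "X \<in> contract_g (lifted_circuits P)"
    show "X \<in> C"
    proof (rule ccontr)
      assume "X \<notin> C"
      then have min: "min_straddles P X" using X image by (auto simp: contract_g_def)
      obtain W where "W \<in> C" "supp W \<subset> supp X" using circuit_inside_min_straddles[OF P min] by blast
      then show False using X image circuit_nonempty unfolding contract_g_def by blast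
    qed
  next
    fix Y assume Y: "Y \<in> C"
    have "\<not> supp W \<subset> supp Y" if "W \<in> C \<union> {X. min_straddles P X}" for W
    proof
      assume sub: "supp W \<subset> supp Y"
      show False
      proof (cases "W \<in> C")
        case True
        then have "W = Y \<or> W = neg Y" using circuit_clutter[OF True Y] sub by blast
        then show False using sub by auto
      next
        case False
        then have "straddles P W" using that by (simp add: min_straddles_def)
        then show False using sub straddles_not_le_circuit[OF P _ Y] by blast
      qed
    qed
    then show "Y \<in> contract_g (lifted_circuits P)"
      using Y circuit_nonempty[OF Y] unfolding contract_g_def image by blast
  qed
qed

lemma colocalization_sign_of:
  assumes P: "generic P"
  shows "colocalization E C (sign_of P)" "general_position C (sign_of P)"
proof -
  have "lifting E C (lifted_circuits P)"
    unfolding lifting_def using oriented_matroid_lifted_circuits[OF P] contract_lifted_circuits[OF P] by blast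
  moreover have "\<forall>Y\<in>C. lift_signed Y (sign_of P Y) \<in> lifted_circuits P"
    by (simp add: lift_mem_lifted_circuits)
  ultimately show "colocalization E C (sign_of P)"
    unfolding colocalization_def using sign_of_generic(5)[OF P] by blast
  show "general_position C (sign_of P)"
    unfolding general_position_def using sign_of_generic(4)[OF P] by blast
qed

text \<open>The lifting is arbitrary here. Its circuits through \<open>g\<close> with a further
  element restrict to circuits of \<open>C\<close>; elimination between positive ones may lose
  \<open>g\<close>, and then a positive circuit has to be recovered below the result.\<close>

lemma generic_of_colocalization:
  assumes "colocalization E C \<sigma>" "general_position C \<sigma>"
  shows "generic {Y \<in> C. \<sigma> Y = Pos}" and "\<sigma> = sign_of {Y \<in> C. \<sigma> Y = Pos}"
proof -
  obtain Ct where outside: "\<And>Y. Y \<notin> C \<Longrightarrow> \<sigma> Y = Zero"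
    and omt: "oriented_matroid (insert None (Some ` E)) Ct" and contract: "contract_g Ct = C"
    and lift: "\<And>Y. Y \<in> C \<Longrightarrow> lift_signed Y (\<sigma> Y) \<in> Ct"
    using assms(1) unfolding colocalization_def lifting_def by blast
  have nonzero: "\<And>Y. Y \<in> C \<Longrightarrow> \<sigma> Y \<noteq> Zero" using assms(2) by (simp add: general_position_def)
  interpret L: oriented_matroid_on "insert None (Some ` E)" Ct
    by unfold_locales (simp_all add: finite_E omt)
  \<comment> \<open>\<open>contract_g\<close> keeps the minimal nonempty restrictions; a smallest
    one inside \<open>supp X\<close> is among them.\<close>
  have contains_circuit: "\<exists>Y\<in>C. supp Y \<subseteq> supp X" if X: "lift_signed X s \<in> Ct" "supp X \<noteq> {}" for X s
  proof -
    let ?Q = "\<lambda>Z. Z \<in> restrict_signed ` Ct \<and> supp Z \<noteq> {} \<and> supp Z \<subseteq> supp X"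
    have "X \<in> restrict_signed ` Ct" using X(1) by (metis imageI restrict_lift_signed)
    then have "?Q X" using X(2) by blast
    then obtain Z where Z: "?Q Z" and least: "\<And>Z'. ?Q Z' \<Longrightarrow> card (supp Z) \<le> card (supp Z')"
      using ex_has_least_nat[of ?Q X "\<lambda>Z. card (supp Z)"] by blast
    have "Some ` supp X \<subseteq> supp (lift_signed X s)" by auto
    then have "finite (Some ` supp X)" using L.finite_supp[OF X(1)] finite_subset by blast
    then have "finite (supp X)" by (simp add: finite_image_iff)
    then have fin: "finite (supp Z)" using Z finite_subset by blast
    have "\<not> supp W \<subset> supp Z" if W: "W \<in> restrict_signed ` Ct" "supp W \<noteq> {}" for W
    proof
      assume sub: "supp W \<subset> supp Z"
      then have "card (supp Z) \<le> card (supp W)" using least[of W] W Z by blast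
      then show False using psubset_card_mono[OF fin sub] by simp
    qed
    then have "Z \<in> contract_g Ct" using Z unfolding contract_g_def by blast
    then show ?thesis using contract Z by blast
  qed
  \<comment> \<open>As \<sigma> has no zeros on \<open>C\<close>, both lifts contain
    \<open>g\<close> and have the same support, so the clutter axiom relates them.\<close>
  have odd: "\<sigma> (neg Y) = neg_sign (\<sigma> Y)" if Y: "Y \<in> C" for Y
  proof -
    have nY: "neg Y \<in> C" using Y by simp
    have "supp (lift_signed (neg Y) (\<sigma> (neg Y))) \<subseteq> supp (lift_signed Y (\<sigma> Y))"
      using nonzero[OF Y] by simp
    then have "lift_signed (neg Y) (\<sigma> (neg Y)) = lift_signed Y (\<sigma> Y) \<or>
        lift_signed (neg Y) (\<sigma> (neg Y)) = neg (lift_signed Y (\<sigma> Y))"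
      by (rule L.circuit_clutter[OF lift[OF nY] lift[OF Y]])
    then show ?thesis using circuit_neq_neg[OF Y] by (auto simp: neg_lift_signed)
  qed
  have lift_circuit: "X \<in> C \<and> \<sigma> X = s"
    if X: "lift_signed X s \<in> Ct" "s \<noteq> Zero" "supp X \<noteq> {}" for X s
  proof -
    obtain Y where Y: "Y \<in> C" "supp Y \<subseteq> supp X" using contains_circuit X by blast
    then have "lift_signed Y (\<sigma> Y) = lift_signed X s \<or> lift_signed Y (\<sigma> Y) = neg (lift_signed X s)"
      using L.circuit_clutter[OF lift[OF Y(1)] X(1)] X(2) by simp
    then consider "X = Y" "s = \<sigma> Y" | "Y = neg X" "\<sigma> Y = neg_sign s" by (auto simp: neg_lift_signed)
    then show ?thesis
    proof cases
      case 2
      then have "X = neg Y" by simp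
      then show ?thesis using odd[OF Y(1)] 2(2) Y(1) by (cases s) auto
    qed (use Y in simp)
  qed
  have elim_lift: "\<exists>Z s. lift_signed Z s \<in> Ct \<and> Z \<sqsubseteq> elim X Y e \<and> s \<in> {Zero, Pos} \<and> supp Z \<noteq> {}"
    if X: "X \<in> C" "\<sigma> X = Pos" and Y: "lift_signed Y b \<in> Ct" "b \<in> {Zero, Pos}" and e: "e \<in> sepr X Y"
    for X Y b e
  proof -
    have lX: "lift_signed X Pos \<in> Ct" using lift[OF X(1)] X(2) by simp
    have "lift_signed X Pos \<noteq> neg (lift_signed Y b)" using Y(2) by (auto simp: neg_lift_signed)
    moreover have "Some e \<in> sepr (lift_signed X Pos) (lift_signed Y b)"
      using e by (simp add: sepr_def)
    ultimately obtain Z' where Z': "Z' \<in> Ct" "Z' \<sqsubseteq> elim (lift_signed X Pos) (lift_signed Y b) (Some e)"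
      using L.weak_elim[OF lX Y(1)] by blast
    obtain s where s: "Z' = lift_signed (restrict_signed Z') s"
      using lift_signed_surj[OF L.circuit_disjoint[OF Z'(1)]] by blast
    let ?Z = "restrict_signed Z'"
    have Z: "lift_signed ?Z s \<in> Ct" "?Z \<sqsubseteq> elim X Y e" "s \<noteq> Zero \<longrightarrow> s = Pos \<or> s = b"
      using Z' s lift_signed_le_elim_Some[of ?Z s X Pos Y b e] by simp_all
    \<comment> \<open>The support of a circuit inside \<open>{g}\<close> would lie inside that of
      the lift of \<open>X\<close>, contrary to the clutter axiom.\<close>
    have "supp ?Z \<noteq> {}"
    proof
      assume empty: "supp ?Z = {}"
      then have "supp (lift_signed ?Z s) \<subseteq> supp (lift_signed X Pos)" by simp
      then have "supp ?Z = supp X"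
        using L.circuit_clutter[OF Z(1) lX] by (auto simp: neg_lift_signed)
      then show False using empty circuit_nonempty[OF X(1)] by simp
    qed
    then show ?thesis using Z Y(2) by blast
  qed
  have pos_below: "\<exists>Y\<in>C. \<sigma> Y = Pos \<and> Y \<sqsubseteq> X" if X: "lift_signed X Zero \<in> Ct" "supp X \<noteq> {}" for X
  proof -
    \<comment> \<open>Positive circuits inside \<open>supp X\<close> with arbitrary signs. One with
      fewest conflicts with \<open>X\<close> lies below \<open>X\<close>, since eliminating a
      conflict would give a better one.\<close>
    let ?Q = "\<lambda>Y. Y \<in> C \<and> \<sigma> Y = Pos \<and> supp Y \<subseteq> supp X"
    obtain Y0 where Y0: "Y0 \<in> C" "supp Y0 \<subseteq> supp X" using contains_circuit X by blast
    then have "?Q Y0 \<or> ?Q (neg Y0)"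
      using nonzero[OF Y0(1)] odd[OF Y0(1)] by (cases "\<sigma> Y0") auto
    then have "\<exists>Y. ?Q Y" by blast
    then obtain Y where Y: "?Q Y" and least: "\<And>Y'. ?Q Y' \<Longrightarrow> card (sepr Y X) \<le> card (sepr Y' X)"
      using ex_has_least_nat[of ?Q _ "\<lambda>Y. card (sepr Y X)"] by blast
    show ?thesis
    proof (cases "sepr Y X = {}")
      case True
      then have "Y \<sqsubseteq> X" using Y by (auto simp: conformal_le_def sepr_def supp_def)
      then show ?thesis using Y by blast
    next
      case False
      then obtain d where d: "d \<in> sepr Y X" by blast
      then obtain Z s where Z: "lift_signed Z s \<in> Ct" "Z \<sqsubseteq> elim Y X d" "s \<in> {Zero, Pos}" "supp Z \<noteq> {}"
        using elim_lift[of Y X Zero d] Y X(1) by blast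
      have Zs: "supp Z \<subseteq> supp X" "d \<notin> supp Z"
        using Z(2) Y by (auto simp: conformal_le_def elim_def supp_def)
      have dX: "d \<in> supp X" using d by (auto simp: sepr_def supp_def)
      \<comment> \<open>A result avoiding \<open>g\<close> would be \<open>X\<close> or its
        negative, but \<open>d\<close> has been eliminated.\<close>
      have "s \<noteq> Zero"
      proof
        assume "s = Zero"
        then have "Z = X \<or> Z = neg X"
          using L.circuit_clutter[OF Z(1) X(1)] Zs by (auto simp: neg_lift_signed)
        then show False using Zs(2) dX by auto
      qed
      then have "?Q Z" using lift_circuit[OF Z(1) _ Z(4)] Z(3) Zs(1) by auto
      then have "card (sepr Y X) \<le> card (sepr Z X)" by (rule least)
      moreover have "fst X \<inter> snd X = {}"
      proof -
        have "fst (lift_signed X Zero) \<inter> snd (lift_signed X Zero) = {}"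
          by (rule L.circuit_disjoint[OF X(1)])
        then show ?thesis by (auto simp: lift_signed_def)
      qed
      then have "sepr Z X \<subset> sepr Y X"
        using Z(2) d by (auto simp: conformal_le_def elim_def sepr_def)
      then have "card (sepr Z X) < card (sepr Y X)"
        using Y by (intro psubset_card_mono finite_sepr) auto
      ultimately show ?thesis by simp
    qed
  qed
  let ?P = "{Y \<in> C. \<sigma> Y = Pos}"
  have half: "Y \<in> ?P \<longleftrightarrow> neg Y \<notin> ?P" if "Y \<in> C" for Y
    using that odd[OF that] nonzero[OF that] by (cases "\<sigma> Y") auto
  have elim: "\<exists>Z\<in>?P. Z \<sqsubseteq> elim X Y e" if X: "X \<in> ?P" and Y: "Y \<in> ?P" and e: "e \<in> sepr X Y" for X Y e
  proof -
    have "lift_signed Y Pos \<in> Ct" using lift[of Y] Y by simp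
    then obtain Z s where Z: "lift_signed Z s \<in> Ct" "Z \<sqsubseteq> elim X Y e" "s \<in> {Zero, Pos}" "supp Z \<noteq> {}"
      using elim_lift[of X Y Pos e] X e by blast
    show ?thesis
    proof (cases "s = Zero")
      case True
      then obtain V where "V \<in> C" "\<sigma> V = Pos" "V \<sqsubseteq> Z" using pos_below Z by blast
      then show ?thesis using Z(2) conformal_le_trans by blast
    next
      case False
      then have "Z \<in> ?P" using lift_circuit[OF Z(1) False Z(4)] Z(3) by simp
      then show ?thesis using Z(2) by blast
    qed
  qed
  show "generic ?P"
    unfolding generic_def
  proof (intro conjI ballI)
    show "?P \<subseteq> C" by blast
  qed (rule half elim, assumption+)+
  show "\<sigma> = sign_of ?P"
  proof
    fix Y
    show "\<sigma> Y = sign_of ?P Y"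
      using outside[of Y] nonzero[of Y] odd[of Y]
      by (cases "Y \<in> C"; cases "\<sigma> Y") (auto simp: sign_of_def)
  qed
qed

section \<open>Matching tight collections, generic sets and colocalizations\<close>

lemma colocalization_iff_generic:
  "colocalization E C \<sigma> \<and> general_position C \<sigma> \<longleftrightarrow> (\<exists>P. generic P \<and> \<sigma> = sign_of P)"
  using generic_of_colocalization colocalization_sign_of by blast

lemma sigma_of_tight:
  assumes "separated_collection E C S" "card S = card (Ind E C)"
  shows "sigma_of C S = sign_of {Y \<in> C. \<exists>T\<in>S. orients_pos T Y}"
proof
  fix Y
  show "sigma_of C S Y = sign_of {Y \<in> C. \<exists>T\<in>S. orients_pos T Y} Y"
    by (simp add: sigma_of_def sign_of_def orients_neg_iff)
qed

text \<open>A tight collection orients every circuit in some way, and \<open>regions P\<close> never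
  orients a circuit of \<open>P\<close> negatively; so the circuits it orients positively are
  exactly those of \<open>P\<close>.\<close>

lemma max_by_size_regions:
  assumes P: "generic P"
  shows "max_by_size E C (regions P)" "sigma_of C (regions P) = sign_of P"
proof -
  have S: "separated_collection E C (regions P)" "card (regions P) = card (Ind E C)"
    using separated_regions[OF P] card_regions[OF P] by auto
  then show "max_by_size E C (regions P)" by (simp add: max_by_size_iff)
  have "Y \<in> P \<longleftrightarrow> Y \<in> C \<and> (\<exists>T\<in>regions P. orients_pos T Y)" for Y
  proof
    assume Y: "Y \<in> P"
    then have "Y \<in> C" "neg Y \<notin> P" using genericD(1)[OF P Y] genericD(2)[OF P] by auto
    moreover have "\<not> orients_pos T (neg Y)" if "T \<in> regions P" for T
      using that \<open>Y \<in> C\<close> \<open>neg Y \<notin> P\<close> by (auto simp: regions_def)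
    ultimately show "Y \<in> C \<and> (\<exists>T\<in>regions P. orients_pos T Y)"
      using tight_orients_circuit[OF S] by blast
  qed (auto simp: regions_def)
  then have "{Y \<in> C. \<exists>T\<in>regions P. orients_pos T Y} = P" by blast
  then show "sigma_of C (regions P) = sign_of P" using sigma_of_tight[OF S] by simp
qed

text \<open>\<open>S\<close> consists of regions of the generic set it defines, and both families
  have \<open>card (Ind E C)\<close> members.\<close>

lemma max_by_size_generic:
  assumes "max_by_size E C S"
  obtains P where "generic P" "sigma_of C S = sign_of P" "S = regions P"
proof
  have S: "separated_collection E C S" "card S = card (Ind E C)"
    using assms by (simp_all add: max_by_size_iff)
  let ?P = "{Y \<in> C. \<exists>T\<in>S. orients_pos T Y}"
  show P: "generic ?P" by (rule tight_generic[OF S])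
  show "sigma_of C S = sign_of ?P" by (rule sigma_of_tight[OF S])
  have "S \<subseteq> regions ?P" using S(1) by (auto simp: separated_collection_def regions_def)
  moreover have "finite (regions ?P)"
    by (rule finite_subset[of _ "Pow E"]) (auto simp: regions_def finite_E)
  ultimately show "S = regions ?P" using card_regions[OF P] S(2) by (intro card_subset_eq) auto
qed

end

theorem theorem7p2:
  fixes E :: "'a set" and C :: "'a signed set"
  assumes "finite E" and "oriented_matroid E C"
  shows "(\<forall>S. separated_collection E C S \<longrightarrow> card S \<le> card (Ind E C))
    \<and> (\<forall>S. max_by_size E C S \<longrightarrow> card S = card (Ind E C))
    \<and> bij_betw (sigma_of C) {S. max_by_size E C S}
         {\<sigma>. colocalization E C \<sigma> \<and> general_position C \<sigma>}
    \<and> (\<forall>\<sigma>. colocalization E C \<sigma> \<and> general_position C \<sigma> \<longrightarrow>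
           max_by_size E C (S_of E C \<sigma>) \<and> sigma_of C (S_of E C \<sigma>) = \<sigma>)
    \<and> (\<forall>S. max_by_size E C S \<longrightarrow> S_of E C (sigma_of C S) = S)"
proof -
  interpret oriented_matroid_on E C by unfold_locales (fact assms)+
  have to_sigma: "colocalization E C (sigma_of C S) \<and> general_position C (sigma_of C S)
      \<and> S_of E C (sigma_of C S) = S" if S: "max_by_size E C S" for S
  proof -
    obtain P where P: "generic P" "sigma_of C S = sign_of P" "S = regions P"
      using max_by_size_generic[OF S] .
    show ?thesis
      unfolding P(2) using colocalization_sign_of[OF P(1)] S_of_sign_of[OF P(1)] P(3) by simp
  qed
  have of_sigma: "max_by_size E C (S_of E C \<sigma>) \<and> sigma_of C (S_of E C \<sigma>) = \<sigma>"
    if \<sigma>: "colocalization E C \<sigma> \<and> general_position C \<sigma>" for \<sigma>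
  proof -
    obtain P where P: "generic P" "\<sigma> = sign_of P" using \<sigma> colocalization_iff_generic by blast
    show ?thesis unfolding P(2) S_of_sign_of[OF P(1)] using max_by_size_regions[OF P(1)] by simp
  qed
  have "bij_betw (sigma_of C) {S. max_by_size E C S}
      {\<sigma>. colocalization E C \<sigma> \<and> general_position C \<sigma>}"
    by (rule bij_betw_byWitness[where f' = "S_of E C"]) (use to_sigma of_sigma in auto)
  then show ?thesis
    using card_separated_le max_by_size_iff to_sigma of_sigma by blast
qed

end
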